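(* Let $1\le r<d<n$ be integers with $n\ge 3$ and let $V$ be an $n$-dimensional real or complex Hilbert space. A subset $S\subseteq \mathbb{G}(r,V)$ is $\tau_d$-saturated if and only if it is a disjoint union of spines $$S=\bigsqcup_{i\in I}\left(\pi_i\right)^{\uparrow}_{\mathbb{G}(r,V)}$$ for some family $\{\pi_i\}_{i\in I}$ of subspaces of $V$, each of dimension at most $r$ (i.e. $\{\pi_i\}_{i\in I}\subseteq \bigsqcup_{0\le r'\le r}\mathbb{G}(r',V)$), such that $\pi_i\oslash_d \pi_j$ for all $i\ne j$ in $I$.
   Context: $\mathbb{G}(k,V)$ denotes the Grassmannian of $k$-dimensional linear subspaces of $V$ (over the real or complex scalar field of $V$). For a subspace $\zeta\le V$, $P_\zeta$ is the orthogonal projection of $V$ onto $\zeta$, and $P_\zeta\eta'$ is the image of the subspace $\eta'$ under $P_\zeta$. The ternary relation $\tau_d$ on $\mathbb{G}(r,V)$: for $\eta,\eta',\eta''\in\mathbb{G}(r,V)$, $\tau_d(\eta,\eta'\mid\eta'')$ holds if and only if there is $\zeta\in\mathbb{G}(d,V)$ with $\eta\le\zeta$ and $\eta''=P_\zeta\eta'$. A subset $S\subseteq\mathbb{G}(r,V)$ is $\tau_d$-saturated if whenever $\eta,\eta'\in S$, $\eta''\in\mathbb{G}(r,V)$ and $\tau_d(\eta,\eta'\mid\eta'')$, then $\eta''\in S$. Spine: for a subspace $\pi\le V$ of dimension at most $r$, $\pi^{\uparrow}_{\mathbb{G}(r,V)}:=\{\widetilde{\pi}\in\mathbb{G}(r,V):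 \widetilde{\pi}\ge\pi\}$. $d$-distal relation: for integers $0\le k,k'<d<n$ and subspaces $\pi\in\mathbb{G}(k,V)$, $\pi'\in\mathbb{G}(k',V)$, write $\pi\oslash_d\pi'$ if $\dim(\pi\cap\pi'^{\perp})>d-k'$. The index set $I$ is allowed to be empty (giving $S=\emptyset$). *)

theory Defs
  imports Complex_Main "HOL-Library.Nonpos_Ints" "HOL-Library.Disjoint_Sets"
begin

(* The Hilbert space V is the whole type 'v.  The conjugation cj of the scalar field is a
   parameter: the real case is 'k = real, cj = id, the complex case is 'k = complex, cj = cnj.
   The inner product is linear in the first argument.  Completeness is not assumed separately,
   being automatic in finite dimension. *)
locale fin_dim_hilbert_space = vector_space scale
  for scale :: "'k::real_field \<Rightarrow> 'v::ab_group_add \<Rightarrow> 'v" +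
  fixes cj :: "'k \<Rightarrow> 'k"
    and ip :: "'v \<Rightarrow> 'v \<Rightarrow> 'k"
  assumes ip_add_left: "ip (x + y) z = ip x z + ip y z"
    and ip_scale_left: "ip (scale c x) y = c * ip x y"
    and ip_commute: "ip y x = cj (ip x y)"
    and ip_nonneg: "ip x x \<in> \<real>\<^sub>\<ge>\<^sub>0"
    and ip_definite: "ip x x = 0 \<Longrightarrow> x = 0"
    and finite_dim: "\<exists>B. finite B \<and> span B = UNIV"
begin

definition grassmannian :: "nat \<Rightarrow> 'v set set" where
  "grassmannian k = {W. subspace W \<and> dim W = k}"

definition orth_compl :: "'v set \<Rightarrow> 'v set" where
  "orth_compl W = {x. \<forall>w\<in>W. ip x w = 0}"

definition orth_proj :: "'v set \<Rightarrow> 'v \<Rightarrow> 'v" where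
  "orth_proj W x = (THE y. y \<in> W \<and> x - y \<in> orth_compl W)"

definition tau :: "nat \<Rightarrow> 'v set \<Rightarrow> 'v set \<Rightarrow> 'v set \<Rightarrow> bool" where
  "tau d \<eta> \<eta>' \<eta>'' \<longleftrightarrow> (\<exists>\<zeta>\<in>grassmannian d. \<eta> \<subseteq> \<zeta> \<and> \<eta>'' = orth_proj \<zeta> ` \<eta>')"

definition tau_saturated :: "nat \<Rightarrow> nat \<Rightarrow> 'v set set \<Rightarrow> bool" where
  "tau_saturated r d S \<longleftrightarrow>
     (\<forall>\<eta>\<in>S. \<forall>\<eta>'\<in>S. \<forall>\<eta>''\<in>grassmannian r. tau d \<eta> \<eta>' \<eta>'' \<longrightarrow> \<eta>'' \<in> S)"

definition spine :: "nat \<Rightarrow> 'v set \<Rightarrow> 'v set set" where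
  "spine r \<pi> = {W \<in> grassmannian r. \<pi> \<subseteq> W}"

(* The relation is only considered between subspaces of dimension less than d, so the
   subtraction on nat is never truncated. *)
definition distal :: "nat \<Rightarrow> 'v set \<Rightarrow> 'v set \<Rightarrow> bool" where
  "distal d \<pi> \<pi>' \<longleftrightarrow>
     subspace \<pi> \<and> subspace \<pi>' \<and> dim \<pi> < d \<and> dim \<pi>' < d \<and>
     dim (\<pi> \<inter> orth_compl \<pi>') > d - dim \<pi>'"

(* A family of subspaces indexed by I, where I may be empty.  The spines of subspaces of
   dimension at most r <= dim V are nonempty, so disjointness of the spines forces the
   family to be injective; it can therefore be reindexed by its members, and the index
   type 'v set is no restriction. *)
definition spine_decomposition ::
    "nat \<Rightarrow> nat \<Rightarrow> 'v set set \<Rightarrow> 'v set set \<Rightarrow> ('v set \<Rightarrow> 'v set) \<Rightarrow> bool" where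
  "spine_decomposition r d S I \<pi> \<longleftrightarrow>
     (\<forall>i\<in>I. subspace (\<pi> i) \<and> dim (\<pi> i) \<le> r) \<and>
     S = (\<Union>i\<in>I. spine r (\<pi> i)) \<and>
     disjoint_family_on (\<lambda>i. spine r (\<pi> i)) I \<and>
     (\<forall>i\<in>I. \<forall>j\<in>I. i \<noteq> j \<longrightarrow> distal d (\<pi> i) (\<pi> j))"

end

end

(* Call a subspace \<pi> of dimension at most r full if every member of its spine lies in the saturated
   set S. Everything rests on adjacent members \<kappa> + x, \<kappa> + y of S (dim \<kappa> = r - 1): then \<kappa> is full.
   Modulo \<kappa> this says that a set of lines closed under projection onto planes and containing two
   lines is everything: projections produce circles, on which one finds pairs of lines at ever
   larger angles, eventually at a right angle, and two orthogonal lines generate all others.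
   It follows that \<pi> \<inter> \<sigma> is full if \<pi> and \<sigma> are full and \<pi> \<inter> \<sigma> is a hyperplane of \<pi>.
   If \<pi> and \<pi>' are full and not d-distal, with dim \<pi>' \<le> dim \<pi> and \<pi>' not inside \<pi>, some \<zeta> of
   dimension d contains \<pi> and \<pi>' \<inter> \<pi>\<^sup>\<bottom>; projecting to \<zeta> yields a member of S inside \<zeta>, and
   projecting \<pi> onto a suitable d-dimensional space that contains this member and a hyperplane of \<pi>
   shows that \<pi> has a proper full subspace. So distinct minimal full subspaces are d-distal. *)
theory Submission
  imports Defs
begin

section \<open>Dimension counting and intermediate subspaces\<close>

context finite_dimensional_vector_space
begin

lemma dim_span_insert_notin:
  assumes "subspace A" "x \<notin> A"
  shows "dim (span (insert x A)) = dim A + 1"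
  using assms by (simp add: dim_insert span_eq_iff[THEN iffD2])

lemma subspace_dim_less:
  assumes "subspace A" "subspace B" "A \<subset> B"
  shows "dim A < dim B"
  using assms by (metis dim_psubset span_eq_iff)

lemma span_insert_eq_subspace:
  assumes "subspace A" "subspace B" "A \<subseteq> B" "x \<in> B" "x \<notin> A" "dim B = dim A + 1"
  shows "B = span (insert x A)"
proof -
  have "span (insert x A) \<subseteq> B"
    using assms by (intro span_minimal) auto
  then show ?thesis
    using assms dim_span_insert_notin[of A x] subspace_dim_equal[of "span (insert x A)" B] by simp
qed

lemma dim_subspace_span_Un:
  assumes "subspace A" "subspace B"
  shows "dim (span (A \<union> B)) + dim (A \<inter> B) = dim A + dim B"
  using dim_sums_Int[OF assms] assms
  by (simp only: span_Un) (simp only: span_eq_iff[THEN iffD2] )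

text \<open>Grow \<open>A\<close> inside \<open>B\<close> one vector at a time. As long as
  \<open>C + x\<close> is not all of \<open>B\<close>, some \<open>y\<close> of \<open>B\<close>
  lies outside it, and by exchange \<open>x\<close> stays outside \<open>C + y\<close>.\<close>

lemma subspace_between_avoiding:
  assumes "subspace A" "subspace B" "A \<subseteq> B" "x \<in> B" "x \<notin> A" "dim A \<le> m" "m < dim B"
  shows "\<exists>C. subspace C \<and> A \<subseteq> C \<and> C \<subseteq> B \<and> x \<notin> C \<and> dim C = m"
  using assms(6,7)
proof (induction m rule: dec_induct)
  case base
  then show ?case using assms by auto
next
  case (step m)
  then obtain C where C: "subspace C" "A \<subseteq> C" "C \<subseteq> B" "x \<notin> C" "dim C = m"
    by auto
  have "\<not> B \<subseteq> span (insert x C)"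
    using dim_span_insert_notin[OF C(1,4)] step.prems C(5) dim_subset[of B "span (insert x C)"] by auto
  then obtain y where y: "y \<in> B" "y \<notin> span (insert x C)"
    by blast
  have "y \<notin> C"
    using y(2) span_base by blast
  moreover have "x \<notin> span (insert y C)"
    using in_span_insert[of x y C] C(1,4) y(2) by (metis span_eq_iff)
  moreover have "span (insert y C) \<subseteq> B"
    using C(3) y(1) assms(2) by (intro span_minimal) auto
  moreover have "A \<subseteq> span (insert y C)"
    using C(2) span_superset by blast
  ultimately show ?case
    using dim_span_insert_notin[OF C(1), of y] C(5) by (intro exI[of _ "span (insert y C)"]) auto
qed

lemma subspace_between:
  assumes "subspace A" "subspace B" "A \<subseteq> B" "dim A \<le> m" "m \<le> dim B"
  shows "\<exists>C. subspace C \<and> A \<subseteq> C \<and> C \<subseteq> B \<and> dim C = m"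
proof (cases "m = dim B \<or> A = B")
  case True
  then show ?thesis using assms by auto
next
  case False
  then obtain x where "x \<in> B" "x \<notin> A"
    using assms(3) by blast
  then show ?thesis
    using subspace_between_avoiding[OF assms(1-3), of x m] assms(4,5) False by auto
qed

end

section \<open>Orthogonal projections\<close>

text \<open>Treats the real and the complex case at once: these laws hold both for the identity and
  for complex conjugation.\<close>

locale conjugation_hilbert_space = fin_dim_hilbert_space scale cj ip
  for scale :: "'k::real_field \<Rightarrow> 'v::ab_group_add \<Rightarrow> 'v" and cj ip +
  assumes cj_add: "cj (a + b) = cj a + cj b"
    and cj_mult: "cj (a * b) = cj a * cj b"
    and cj_of_real: "cj (of_real t) = of_real t"
begin

text \<open>The locale \<open>finite_dimensional_vector_space\<close> has a basis as a parameter, so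
  one is chosen to instantiate it.\<close>

definition some_basis :: "'v set" where
  "some_basis = (SOME B. finite B \<and> independent B \<and> span B = UNIV)"

lemma some_basis: "finite some_basis \<and> independent some_basis \<and> span some_basis = UNIV"
proof -
  obtain S where S: "finite S" "span S = UNIV"
    using finite_dim by blast
  obtain B where B: "B \<subseteq> S" "independent B" "S \<subseteq> span B"
    using maximal_independent_subset[of S] by blast
  then have "finite B \<and> independent B \<and> span B = UNIV"
    using S by (metis finite_subset span_mono span_span top.extremum_uniqueI)
  then show ?thesis
    unfolding some_basis_def by (rule someI)
qed

sublocale finite_dimensional_vector_space scale some_basis
  using some_basis by unfold_locales auto

declare dim_UNIV [simp del] dim_eq_0 [simp del]

lemma cj_0 [simp]: "cj 0 = 0"
  using cj_of_real[of 0] by simp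

lemma cj_1 [simp]: "cj 1 = 1"
  using cj_of_real[of 1] by simp

lemma ip_add_right: "ip x (y + z) = ip x y + ip x z"
  by (metis ip_commute ip_add_left cj_add)

lemma ip_scale_right: "ip x (scale c y) = cj c * ip x y"
  by (metis ip_commute ip_scale_left cj_mult)

lemma ip_0_left [simp]: "ip 0 x = 0"
  using ip_add_left[of 0 0 x] by simp

lemma ip_0_right [simp]: "ip x 0 = 0"
  using ip_add_right[of x 0 0] by simp

lemma ip_minus_left: "ip (- x) y = - ip x y"
  using ip_add_left[of x "- x" y] by (simp add: eq_neg_iff_add_eq_0 add.commute)

lemma ip_minus_right: "ip x (- y) = - ip x y"
  using ip_add_right[of x y "- y"] by (simp add: eq_neg_iff_add_eq_0 add.commute)

lemma ip_diff_left: "ip (x - y) z = ip x z - ip y z"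
  using ip_add_left[of x "- y" z] by (simp add: ip_minus_left)

lemma ip_diff_right: "ip x (y - z) = ip x y - ip x z"
  using ip_add_right[of x y "- z"] by (simp add: ip_minus_right)

lemmas ip_linear = ip_add_left ip_add_right ip_diff_left ip_diff_right ip_scale_left
  ip_scale_right ip_minus_left ip_minus_right cj_of_real

lemma ip_eq_0_commute: "ip x y = 0 \<longleftrightarrow> ip y x = 0"
  by (metis ip_commute cj_0)

lemma ip_self_eq_0_iff [simp]: "ip x x = 0 \<longleftrightarrow> x = 0"
  using ip_definite by auto

lemma ip_self_of_real:
  assumes "x \<noteq> 0"
  obtains m where "m > 0" "ip x x = of_real m"
proof -
  obtain m where "ip x x = of_real m" "m \<ge> 0"
    using ip_nonneg[of x] by (rule nonneg_Reals_cases)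
  then show thesis
    using that[of m] assms ip_self_eq_0_iff[of x] by (cases "m = 0") auto
qed

section \<open>Orthogonal complements and orthogonal decomposition\<close>

lemma subspace_orth_compl [simp]: "subspace (orth_compl W)"
  by (rule subspaceI) (auto simp: orth_compl_def ip_linear)

lemma orth_compl_span [simp]: "orth_compl (span W) = orth_compl W"
proof
  show "orth_compl (span W) \<subseteq> orth_compl W"
    by (auto simp: orth_compl_def span_base)
  show "orth_compl W \<subseteq> orth_compl (span W)"
  proof
    fix x assume "x \<in> orth_compl W"
    then have "W \<subseteq> {y. ip x y = 0}"
      by (auto simp: orth_compl_def)
    moreover have "subspace {y. ip x y = 0}"
      by (rule subspaceI) (auto simp: ip_linear)
    ultimately have "span W \<subseteq> {y. ip x y = 0}"
      by (rule span_minimal)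
    then show "x \<in> orth_compl (span W)"
      by (auto simp: orth_compl_def)
  qed
qed

lemma Int_orth_compl_trivial: "x \<in> W \<Longrightarrow> x \<in> orth_compl W \<Longrightarrow> x = 0"
  by (auto simp: orth_compl_def)

lemma ex_orth_decomposition_span:
  "finite B \<Longrightarrow> \<exists>y\<in>span B. x - y \<in> orth_compl (span B)"
proof (induction B arbitrary: x rule: finite_induct)
  case empty
  then show ?case by (auto simp: orth_compl_def)
next
  case (insert b B)
  obtain p where p: "p \<in> span B" "b - p \<in> orth_compl (span B)"
    using insert.IH by blast
  obtain y where y: "y \<in> span B" "x - y \<in> orth_compl (span B)"
    using insert.IH by blast
  define q where "q = b - p"
  \<comment> \<open>Gram-Schmidt: \<open>q\<close> is the part of \<open>b\<close> orthogonal to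
    \<open>span B\<close>, and \<open>y\<close> is corrected by the component of
    \<open>x - y\<close> along \<open>q\<close>. If \<open>b\<close> lies in \<open>span B\<close>,
    then \<open>q = 0\<close> and the correction vanishes.\<close>
  define z where "z = y + scale (ip (x - y) q / ip q q) q"
  have sub: "span B \<subseteq> span (insert b B)"
    by (rule span_mono) auto
  have q: "q \<in> span (insert b B)"
    unfolding q_def using p(1) sub by (auto intro: span_diff span_base)
  then have z: "z \<in> span (insert b B)"
    unfolding z_def using y(1) sub by (intro span_add span_scale) auto
  have "ip (x - z) w = 0" if "w \<in> B" for w
    using p(2) y(2) that span_base[of w B] unfolding z_def q_def
    by (auto simp: orth_compl_def ip_linear)
  moreover have "ip (x - z) b = 0"
  proof -
    have 1: "ip (x - z) p = 0"
      using p y(2) unfolding z_def q_def by (auto simp: orth_compl_def ip_linear)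
    have "ip (x - z) q = 0"
      unfolding z_def by (cases "q = 0") (auto simp: ip_linear)
    then show ?thesis
      using 1 unfolding q_def by (simp add: ip_linear)
  qed
  ultimately have "x - z \<in> orth_compl (span (insert b B))"
    unfolding orth_compl_span by (auto simp: orth_compl_def)
  with z show ?case by blast
qed

lemma ex_orth_decomposition:
  assumes "subspace W"
  shows "\<exists>y\<in>W. x - y \<in> orth_compl W"
proof -
  obtain B where B: "B \<subseteq> W" "independent B" "W \<subseteq> span B"
    by (rule basis_exists)
  have "span B = W"
    by (rule span_subspace[OF B(1,3) assms])
  then show ?thesis
    using ex_orth_decomposition_span[OF finiteI_independent[OF B(2)], of x] by (simp only:)
qed

section \<open>The orthogonal projection as a linear map, and dimensions of images\<close>

lemma orth_proj_unique:
  assumes "subspace W" "y \<in> W" "x - y \<in> orth_compl W"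
  shows "orth_proj W x = y"
  unfolding orth_proj_def
proof (rule the_equality)
  fix z assume z: "z \<in> W \<and> x - z \<in> orth_compl W"
  have "z - y \<in> orth_compl W"
    using z assms(3) subspace_diff[OF subspace_orth_compl, of "x - y" W "x - z"] by simp
  then show "z = y"
    using Int_orth_compl_trivial[of "z - y" W] z assms subspace_diff by auto
qed (use assms in auto)

lemma
  assumes "subspace W"
  shows orth_proj_in: "orth_proj W x \<in> W"
    and diff_orth_proj: "x - orth_proj W x \<in> orth_compl W"
  using ex_orth_decomposition[OF assms, of x] orth_proj_unique[OF assms] by auto

lemma orth_proj_ident: "subspace W \<Longrightarrow> x \<in> W \<Longrightarrow> orth_proj W x = x"
  by (rule orth_proj_unique) (auto simp: orth_compl_def)

lemma linear_orth_proj: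
  assumes "subspace W"
  shows "Vector_Spaces.linear scale scale (orth_proj W)"
proof unfold_locales
  fix x y c
  have "x + y - (orth_proj W x + orth_proj W y) \<in> orth_compl W"
    using subspace_add[OF subspace_orth_compl diff_orth_proj[OF assms, of x] diff_orth_proj[OF assms, of y]]
    by (simp add: algebra_simps)
  then show "orth_proj W (x + y) = orth_proj W x + orth_proj W y"
    using assms orth_proj_in[OF assms] by (intro orth_proj_unique) (auto intro: subspace_add)
  have "scale c x - scale c (orth_proj W x) = scale c (x - orth_proj W x)"
    by (simp add: scale_right_diff_distrib)
  then have "scale c x - scale c (orth_proj W x) \<in> orth_compl W"
    using subspace_scale[OF subspace_orth_compl diff_orth_proj[OF assms]] by simp
  then show "orth_proj W (scale c x) = scale c (orth_proj W x)"
    using assms orth_proj_in[OF assms] by (intro orth_proj_unique) (auto intro: subspace_scale)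
qed

lemma orth_proj_eq_0_iff:
  assumes "subspace W"
  shows "orth_proj W x = 0 \<longleftrightarrow> x \<in> orth_compl W"
proof
  show "orth_proj W x = 0 \<Longrightarrow> x \<in> orth_compl W"
    using diff_orth_proj[OF assms, of x] by simp
  show "x \<in> orth_compl W \<Longrightarrow> orth_proj W x = 0"
    using assms by (intro orth_proj_unique) (auto intro: subspace_0)
qed

lemma inj_on_orth_proj:
  assumes "subspace W" "subspace A" "A \<inter> orth_compl W \<subseteq> {0}"
  shows "inj_on (orth_proj W) A"
proof -
  interpret p: vector_space_pair scale scale
    by unfold_locales
  show ?thesis
    unfolding p.linear_inj_on_iff_eq_0[OF linear_orth_proj[OF assms(1)] assms(2)]
    using orth_proj_eq_0_iff[OF assms(1)] assms(3) by blast
qed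

lemma dim_orth_proj_image_eq:
  assumes "subspace W" "subspace A" "A \<inter> orth_compl W \<subseteq> {0}"
  shows "dim (orth_proj W ` A) = dim A"
proof -
  interpret p: finite_dimensional_vector_space_pair_1 scale some_basis scale
    by unfold_locales
  show ?thesis
    using p.dim_image_eq[OF linear_orth_proj[OF assms(1)], of A] inj_on_orth_proj[OF assms] assms(2)
    by (simp add: span_eq_iff[THEN iffD2])
qed

lemma dim_orth_proj_image_le:
  assumes "subspace W"
  shows "dim (orth_proj W ` A) \<le> dim A"
proof -
  interpret p: finite_dimensional_vector_space_pair_1 scale some_basis scale
    by unfold_locales
  show ?thesis
    using p.dim_image_le[OF linear_orth_proj[OF assms(1)]] .
qed

lemma subspace_orth_proj_image:
  assumes "subspace W" "subspace A"
  shows "subspace (orth_proj W ` A)"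
proof -
  interpret P: Vector_Spaces.linear scale scale "orth_proj W"
    by (rule linear_orth_proj[OF assms(1)])
  show ?thesis
    by (rule P.subspace_image[OF assms(2)])
qed

lemma orth_proj_image_span:
  assumes "subspace W"
  shows "orth_proj W ` span A = span (orth_proj W ` A)"
proof -
  interpret P: Vector_Spaces.linear scale scale "orth_proj W"
    by (rule linear_orth_proj[OF assms(1)])
  show ?thesis
    by (rule P.span_image[symmetric])
qed

text \<open>Since \<open>x\<close> is killed, \<open>A\<close> has the same image as a hyperplane
  \<open>H\<close> of \<open>A\<close> that avoids \<open>x\<close>.\<close>

lemma dim_orth_proj_image_less:
  assumes "subspace W" "subspace A" "x \<in> A" "x \<in> orth_compl W" "x \<noteq> 0"
  shows "dim (orth_proj W ` A) < dim A"
proof -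
  have "dim A \<noteq> 0"
    using assms(3,5) unfolding dim_eq_0 by blast
  then obtain H where H: "subspace H" "H \<subseteq> A" "x \<notin> H" "dim H = dim A - 1"
    using subspace_between_avoiding[of "{0}" A x "dim A - 1"] assms subspace_0[of A] \<open>dim A \<noteq> 0\<close>
    by auto
  then have A: "A = span (insert x H)"
    using \<open>dim A \<noteq> 0\<close> assms(2,3) by (intro span_insert_eq_subspace) auto
  have "orth_proj W x = 0"
    using assms by (simp add: orth_proj_eq_0_iff)
  then have "orth_proj W ` A = span (orth_proj W ` H)"
    using assms(1) unfolding A by (simp add: orth_proj_image_span)
  then have "dim (orth_proj W ` A) \<le> dim H"
    using dim_orth_proj_image_le[OF assms(1), of H] by simp
  then show ?thesis
    using H(4) \<open>dim A \<noteq> 0\<close> by simp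
qed

lemma span_Un_rel_orth_compl:
  assumes "subspace A" "subspace W" "A \<subseteq> W"
  shows "span (A \<union> (W \<inter> orth_compl A)) = W"
proof
  show "span (A \<union> (W \<inter> orth_compl A)) \<subseteq> W"
    using assms by (intro span_minimal) auto
  show "W \<subseteq> span (A \<union> (W \<inter> orth_compl A))"
  proof
    fix x assume "x \<in> W"
    obtain y where "y \<in> A" "x - y \<in> orth_compl A"
      using ex_orth_decomposition[OF assms(1)] by blast
    then have "y + (x - y) \<in> span (A \<union> (W \<inter> orth_compl A))"
      using \<open>x \<in> W\<close> assms by (intro span_add span_base) (auto intro: subspace_diff)
    then show "x \<in> span (A \<union> (W \<inter> orth_compl A))" by simp
  qed
qed

lemma dim_rel_orth_compl:
  assumes "subspace A" "subspace W" "A \<subseteq> W"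
  shows "dim A + dim (W \<inter> orth_compl A) = dim W"
proof -
  have "A \<inter> (W \<inter> orth_compl A) \<subseteq> {0}"
    using Int_orth_compl_trivial by blast
  then have "dim (A \<inter> (W \<inter> orth_compl A)) = 0"
    by (simp add: dim_eq_0)
  moreover have "subspace (W \<inter> orth_compl A)"
    using assms by (simp add: subspace_inter)
  ultimately show ?thesis
    using dim_subspace_span_Un[of A "W \<inter> orth_compl A"] assms(1) span_Un_rel_orth_compl[OF assms]
    by (simp only: True_implies_equals)
qed

lemma dim_orth_compl:
  assumes "subspace A"
  shows "dim A + dim (orth_compl A) = dim UNIV"
  using dim_rel_orth_compl[OF assms, of UNIV] by simp

lemma orth_compl_orth_compl:
  assumes "subspace A"
  shows "orth_compl (orth_compl A) = A"
proof -
  have "A \<subseteq> orth_compl (orth_compl A)"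
    by (auto simp: orth_compl_def ip_eq_0_commute)
  then show ?thesis
    using subspace_dim_equal[of A "orth_compl (orth_compl A)"] assms
      dim_orth_compl[OF assms] dim_orth_compl[of "orth_compl A"] by auto
qed

text \<open>\<open>B \<inter> orth_compl A\<close> is the complement of
  \<open>A + orth_compl B\<close>, whose dimension involves the other intersection. This makes the
  inequality behind \<open>distal\<close> symmetric in its two subspaces.\<close>

lemma dim_Int_orth_compl_symmetric:
  assumes "subspace A" "subspace B"
  shows "dim A + dim (B \<inter> orth_compl A) = dim B + dim (A \<inter> orth_compl B)"
proof -
  have "orth_compl (A \<union> orth_compl B) = B \<inter> orth_compl A"
    using orth_compl_orth_compl[OF assms(2)] by (auto simp: orth_compl_def)
  then have "dim (span (A \<union> orth_compl B)) + dim (B \<inter> orth_compl A) = dim UNIV"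
    using dim_orth_compl[of "span (A \<union> orth_compl B)"] by simp
  then show ?thesis
    using dim_subspace_span_Un[OF assms(1), of "orth_compl B"] dim_orth_compl[OF assms(2)] by simp
qed

section \<open>Sets of lines closed under projection\<close>

text \<open>Below, \<open>X\<close> is the orthogonal complement of a subspace \<open>\<kappa>\<close> of dimension \<open>r - 1\<close>, and \<open>L\<close>
  consists of the nonzero \<open>x \<in> X\<close> with \<open>\<kappa> + x \<in> S\<close>. The assumption \<open>L_proj\<close> is saturation: it says that \<open>w\<close> is the
  projection of \<open>b\<close> to a subspace containing \<open>a\<close>.\<close>

context
  fixes X L :: "'v set"
  assumes subspace_X: "subspace X"
    and L_subset: "L \<subseteq> X - {0}"
    and L_scale: "\<And>a c. a \<in> L \<Longrightarrow> c \<noteq> 0 \<Longrightarrow> scale c a \<in> L"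
    and L_proj: "\<And>a b w. a \<in> L \<Longrightarrow> b \<in> L \<Longrightarrow> w \<in> X \<Longrightarrow> w \<noteq> 0 \<Longrightarrow>
      ip (b - w) a = 0 \<Longrightarrow> ip (b - w) w = 0 \<Longrightarrow> w \<in> L"
    and ex_third: "\<And>a b. a \<in> X \<Longrightarrow> b \<in> X \<Longrightarrow> \<exists>c\<in>X. c \<noteq> 0 \<and> ip c a = 0 \<and> ip c b = 0"
begin

section \<open>From two orthogonal lines to all lines\<close>

lemma L_unscale:
  assumes "scale c a \<in> L"
  shows "a \<in> L"
proof -
  have "c \<noteq> 0"
    using assms L_subset by auto
  then show ?thesis
    using L_scale[OF assms, of "1 / c"] by simp
qed

text \<open>As \<open>a\<close> is orthogonal to both \<open>b\<close> and \<open>v\<close>, the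
  projection of \<open>b\<close> onto the plane of \<open>a\<close> and \<open>v\<close> is a
  multiple \<open>t v\<close>, and \<open>t \<noteq> 0\<close> because \<open>v\<close> is not
  orthogonal to \<open>b\<close>.\<close>

lemma L_orthogonal_swap:
  assumes "a \<in> L" "b \<in> L" "ip a b = 0" "v \<in> X" "ip v a = 0" "ip v b \<noteq> 0"
  shows "v \<in> L"
proof -
  define t where "t = ip b v / ip v v"
  have v: "v \<noteq> 0"
    using assms(6) by auto
  have "t \<noteq> 0"
    using assms(6) v unfolding t_def by (auto simp: ip_eq_0_commute)
  have "scale t v \<in> L"
  proof (rule L_proj[OF assms(1,2)])
    show "scale t v \<in> X"
      using assms(4) subspace_X by (simp add: subspace_scale)
    show "scale t v \<noteq> 0"
      using \<open>t \<noteq> 0\<close> v by simp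
    show "ip (b - scale t v) a = 0"
      using assms(3,5) ip_eq_0_commute[of a b] by (simp add: ip_linear)
    show "ip (b - scale t v) (scale t v) = 0"
      using v unfolding t_def by (simp add: ip_linear)
  qed
  then show ?thesis
    by (rule L_unscale)
qed

text \<open>Two swaps: the part \<open>w\<close> of \<open>b\<close> orthogonal to \<open>a\<close>
  and \<open>v\<close> is obtained from the pair \<open>a\<close>, \<open>b\<close>; then
  \<open>v\<close>, orthogonal to \<open>w\<close> but not to \<open>a\<close>, is obtained from the
  pair \<open>w\<close>, \<open>a\<close>.\<close>

lemma L_orthogonal_generic:
  assumes ab: "a \<in> L" "b \<in> L" "ip a b = 0" and v: "v \<in> X" "ip v a \<noteq> 0"
    and b: "b \<notin> span {a, v}"
  shows "v \<in> L"
proof -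
  obtain p where p: "p \<in> span {a, v}" "b - p \<in> orth_compl (span {a, v})"
    using ex_orth_decomposition[of "span {a, v}"] by auto
  define w where "w = b - p"
  have perp: "ip w y = 0" if "y \<in> span {a, v}" for y
    using p(2) that by (auto simp: w_def orth_compl_def)
  have "w \<noteq> 0"
    using p(1) b by (auto simp: w_def)
  have "span {a, v} \<subseteq> X"
    using ab(1) L_subset v(1) subspace_X by (intro span_minimal) auto
  then have "w \<in> X"
    unfolding w_def using p(1) ab(2) L_subset subspace_X by (intro subspace_diff) auto
  have "ip w b = ip w w + ip w p"
    by (simp add: w_def ip_linear)
  then have "ip w b \<noteq> 0"
    using perp[OF p(1)] \<open>w \<noteq> 0\<close> by simp
  then have "w \<in> L"
    using L_orthogonal_swap[OF ab \<open>w \<in> X\<close>] perp[of a] by (simp add: span_base)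
  then show ?thesis
    using L_orthogonal_swap[of w a v] ab(1) v perp[of a] perp[of v] ip_eq_0_commute[of w v]
    by (simp add: span_base)
qed

lemma L_orthogonal_nonorthogonal:
  assumes ab: "a \<in> L" "b \<in> L" "ip a b = 0" and v: "v \<in> X" "ip v a \<noteq> 0"
  shows "v \<in> L"
proof (cases "b \<in> span {a, v}")
  case False
  then show ?thesis
    using L_orthogonal_generic[OF ab v] by simp
next
  case True
  have X: "a \<in> X" "b \<in> X" "a \<noteq> 0" "b \<noteq> 0"
    using ab(1,2) L_subset by auto
  \<comment> \<open>If \<open>b\<close> lies in the plane of \<open>a\<close> and \<open>v\<close>,
    it is tilted out of it: \<open>b + c\<close> is still orthogonal to \<open>a\<close>, and it
    belongs to \<open>L\<close> by a swap.\<close>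
  obtain c where c: "c \<in> X" "c \<noteq> 0" "ip c a = 0" "ip c b = 0"
    using ex_third[OF X(1,2)] by blast
  have "b \<notin> span {a}"
  proof
    assume "b \<in> span {a}"
    then obtain k where b: "b = scale k a"
      by (auto simp: span_singleton)
    moreover have "ip b a = 0"
      using ab(3) ip_eq_0_commute by blast
    ultimately have "k * ip a a = 0"
      by (simp add: ip_scale_left)
    then show False
      using X b by auto
  qed
  moreover have "b \<in> span (insert v {a})"
    using True by (simp add: insert_commute)
  ultimately have "v \<in> span (insert b {a})"
    by (rule in_span_insert[rotated])
  then have sub: "span {a, v} \<subseteq> span {a, b}"
    by (intro span_minimal) (auto simp: span_base insert_commute)
  have "c \<in> orth_compl (span {a, b})"
    using c unfolding orth_compl_span by (simp add: orth_compl_def)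
  then have "c \<notin> span {a, v}"
    using sub c(2) Int_orth_compl_trivial by blast
  then have "b + c \<notin> span {a, v}"
    using True span_diff[of "b + c" "{a, v}" b] by auto
  moreover have "ip b c = 0" "ip a c = 0" "ip b a = 0"
    using c ab(3) ip_eq_0_commute by blast+
  moreover have "b + c \<in> L"
    using c X \<open>ip b a = 0\<close> subspace_X
    by (intro L_orthogonal_swap[OF ab]) (auto simp: ip_linear subspace_add)
  ultimately show ?thesis
    using L_orthogonal_generic[OF ab(1) _ _ v, of "b + c"] ab(3) by (simp add: ip_linear)
qed

text \<open>A vector \<open>v\<close> orthogonal to \<open>a\<close> is reached through another
  orthogonal pair, spanning the plane of \<open>a\<close> and \<open>v\<close>, whose first member
  \<open>a + v\<close> is not orthogonal to \<open>v\<close>.\<close>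

lemma L_eq_of_orthogonal:
  assumes ab: "a \<in> L" "b \<in> L" "ip a b = 0"
  shows "X - {0} \<subseteq> L"
proof
  fix v assume v: "v \<in> X - {0}"
  have X: "a \<in> X" "a \<noteq> 0"
    using ab(1) L_subset by auto
  show "v \<in> L"
  proof (cases "ip v a = 0")
    case False
    then show ?thesis
      using L_orthogonal_nonorthogonal[OF ab] v by simp
  next
    case True
    then have av: "ip a v = 0"
      using ip_eq_0_commute by blast
    obtain s where s: "ip a a = of_real s" "s > 0"
      using ip_self_of_real[OF X(2)] by metis
    obtain t where t: "ip v v = of_real t" "t > 0"
      using ip_self_of_real[of v] v by auto
    \<comment> \<open>The coefficients, the squared lengths of \<open>v\<close> and
      \<open>a\<close>, make \<open>b'\<close> orthogonal to \<open>a + v\<close>. Neither vector is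
      orthogonal to \<open>a\<close>, so both are in \<open>L\<close> by the previous case.\<close>
    define b' where "b' = scale (of_real t) a - scale (of_real s) v"
    have "a + v \<in> L"
      using X v s t True subspace_X
      by (intro L_orthogonal_nonorthogonal[OF ab]) (auto simp: ip_linear subspace_add)
    moreover have "b' \<in> L"
      using X v s t True subspace_X unfolding b'_def
      by (intro L_orthogonal_nonorthogonal[OF ab])
        (auto simp: ip_linear intro!: subspace_diff subspace_scale)
    moreover have "ip (a + v) b' = 0"
      using s t True av by (simp add: b'_def ip_linear)
    moreover have "ip v (a + v) \<noteq> 0"
      using t True by (simp add: ip_linear)
    ultimately show ?thesis
      using L_orthogonal_nonorthogonal v by blast
  qed
qed

section \<open>From two arbitrary lines to two orthogonal ones\<close>

text \<open>The points are \<open>w p q = a + p f + q e\<close>, where \<open>f = b - a\<close> and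
  \<open>e\<close> are orthogonal to each other and to \<open>a\<close>, both of squared length
  \<open>s\<close>. As \<open>b = w 1 0\<close>, the condition of \<open>L_proj\<close> that
  \<open>b - w p q\<close> be orthogonal to \<open>w p q\<close> reads
  \<open>p^2 + q^2 = p\<close>.\<close>

lemma L_circle:
  assumes "a \<in> L" "b \<in> L" "ip a a = 1" "ip a b = 1" "ip b b = of_real (1 + s)" "s > 0"
  obtains w where "\<And>p q. q\<^sup>2 = p - p\<^sup>2 \<Longrightarrow> w p q \<in> L"
    and "\<And>p q p' q'. ip (w p q) (w p' q') = of_real (1 + s * (p * p' + q * q'))"
proof -
  define f where "f = b - a"
  have X: "a \<in> X" "b \<in> X"
    using assms(1,2) L_subset by auto
  then have "f \<in> X"
    using subspace_X by (simp add: f_def subspace_diff)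
  have ba: "ip b a = 1"
    using ip_commute[of b a] assms(4) by simp
  have fa: "ip f a = 0" and af: "ip a f = 0" and ff: "ip f f = of_real s"
    using assms(3-5) ba by (simp_all add: f_def ip_linear)
  obtain c where c: "c \<in> X" "c \<noteq> 0" "ip c a = 0" "ip c f = 0"
    using ex_third[OF X(1) \<open>f \<in> X\<close>] by blast
  obtain m where m: "m > 0" "ip c c = of_real m"
    using ip_self_of_real[OF c(2)] by blast
  define e where "e = scale (of_real (sqrt (s / m))) c"
  have "e \<in> X"
    using c(1) subspace_X by (simp add: e_def subspace_scale)
  have ea: "ip e a = 0" and ef: "ip e f = 0"
    using c by (simp_all add: e_def ip_linear)
  then have ae: "ip a e = 0" and fe: "ip f e = 0"
    using ip_eq_0_commute by blast+
  have "ip e e = of_real (sqrt (s / m) * sqrt (s / m) * m)"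
    unfolding e_def ip_scale_left ip_scale_right cj_of_real m(2)
    by (simp only: of_real_mult mult.assoc)
  also have "sqrt (s / m) * sqrt (s / m) * m = s"
    using m(1) assms(6) by simp
  finally have ee: "ip e e = of_real s" .
  define w where "w p q = a + (scale (of_real p) f + scale (of_real q) e)" for p q
  have wX: "w p q \<in> X" for p q
    using X \<open>f \<in> X\<close> \<open>e \<in> X\<close> subspace_X
    by (auto simp: w_def intro!: subspace_add subspace_scale)
  have wa: "ip (w p q) a = 1" for p q
    using assms(3) fa ea by (simp add: w_def ip_linear)
  have ww: "ip (w p q) (w p' q') = of_real (1 + s * (p * p' + q * q'))" for p q p' q'
    using assms(3) fa ea af ae ef fe ee ff by (simp add: w_def ip_linear algebra_simps)
  have bw: "ip b (w p q) = of_real (1 + s * p)" for p q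
  proof -
    have "b = w 1 0"
      by (simp add: w_def f_def)
    then show ?thesis
      using ww[of 1 0 p q] by simp
  qed
  have "w p q \<in> L" if "q\<^sup>2 = p - p\<^sup>2" for p q
  proof (rule L_proj[OF assms(1,2) wX])
    show "w p q \<noteq> 0"
      using wa[of p q] by auto
    show "ip (b - w p q) a = 0"
      using ba wa by (simp add: ip_linear)
    have "p * p + q * q = p"
      using that by (simp add: power2_eq_square)
    then show "ip (b - w p q) (w p q) = 0"
      by (simp add: ip_diff_left bw ww)
  qed
  then show thesis
    using ww that by blast
qed

text \<open>In the affine chart with origin \<open>a\<close>, the closure rule yields the circle with diameter
  from \<open>a\<close> to \<open>b\<close>. Two points of it seen from the origin \<open>a\<close> at a right angle span a larger angle
  than \<open>a\<close> and \<open>b\<close>; here \<open>s\<close> is the squared tangent of the angle between \<open>a\<close> and \<open>b\<close>.\<close>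

lemma L_widen:
  assumes "a \<in> L" "b \<in> L" "ip a a = 1" "ip a b = 1" "ip b b = of_real (1 + s)" "s > 0"
  shows "\<exists>a\<in>L. \<exists>b\<in>L. ip a a = 1 \<and> ip a b = 1 \<and> ip b b = of_real (1 + (s + s\<^sup>2 / 4))"
proof -
  obtain w where w: "\<And>p q. q\<^sup>2 = p - p\<^sup>2 \<Longrightarrow> w p q \<in> L"
    and ww: "\<And>p q p' q'. ip (w p q) (w p' q') = of_real (1 + s * (p * p' + q * q'))"
    using L_circle[OF assms] by blast
  \<comment> \<open>The circle points with \<open>p = 1/2\<close>, \<open>q = 1/2\<close> and
    \<open>q = -1/2\<close> have squared length \<open>1 + s / 2\<close> and inner product 1.
    Scaling by \<open>1 / t\<close> and \<open>t\<close> makes the first a unit vector, keeps the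
    inner product, and gives the second squared length \<open>(1 + s / 2)^2\<close>.\<close>
  define t where "t = sqrt (1 + s / 2)"
  have t: "t \<noteq> 0" "t * t = 1 + s / 2"
    using assms(6) by (auto simp: t_def)
  define a' where "a' = scale (of_real (1 / t)) (w (1/2) (1/2))"
  define b' where "b' = scale (of_real t) (w (1/2) (-1/2))"
  have "w (1/2) (1/2) \<in> L" "w (1/2) (-1/2) \<in> L"
    by (rule w; simp add: power2_eq_square)+
  then have "a' \<in> L" "b' \<in> L"
    unfolding a'_def b'_def using t(1) by (auto intro!: L_scale)
  moreover have "ip a' a' = of_real (1 / t * (1 / t * (1 + s / 2)))"
    unfolding a'_def ip_scale_left ip_scale_right cj_of_real ww
    by (simp add: power2_eq_square)
  then have "ip a' a' = 1"
    unfolding t(2)[symmetric] using t(1) by simp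
  moreover have "ip a' b' = of_real (1 / t * (t * 1))"
    by (simp add: a'_def b'_def ip_scale_left ip_scale_right ww cj_of_real)
  then have "ip a' b' = 1"
    using t(1) by simp
  moreover have "ip b' b' = of_real (t * t * (1 + s / 2))"
    by (simp add: b'_def ip_scale_left ip_scale_right ww cj_of_real)
  then have "ip b' b' = of_real (1 + (s + s\<^sup>2 / 4))"
    unfolding t(2) by (simp add: power2_eq_square algebra_simps)
  ultimately show ?thesis
    by blast
qed

text \<open>Iterates \<open>L_widen\<close>. The parameter never decreases, so each round adds at
  least \<open>s^2 / 4\<close> and every bound is eventually exceeded.\<close>

lemma L_wide:
  assumes "a \<in> L" "b \<in> L" "ip a a = 1" "ip a b = 1" "ip b b = of_real (1 + s)" "s > 0"
  shows "\<exists>s' \<ge> s + real k * (s\<^sup>2 / 4). \<exists>a\<in>L. \<exists>b\<in>L.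
    ip a a = 1 \<and> ip a b = 1 \<and> ip b b = of_real (1 + s')"
proof (induction k)
  case 0
  then show ?case
    using assms by auto
next
  case (Suc k)
  then obtain s' a' b' where s': "s' \<ge> s + real k * (s\<^sup>2 / 4)"
    and ab: "a' \<in> L" "b' \<in> L" "ip a' a' = 1" "ip a' b' = 1" "ip b' b' = of_real (1 + s')"
    by blast
  have "s \<le> s'"
    using s' by (smt (verit) divide_nonneg_pos mult_nonneg_nonneg of_nat_0_le_iff zero_le_power2)
  then have "s\<^sup>2 \<le> s'\<^sup>2"
    using assms(6) by (intro power_mono) auto
  then have "s' + s'\<^sup>2 / 4 \<ge> s + real (Suc k) * (s\<^sup>2 / 4)"
    using s' by (simp add: algebra_simps add_divide_distrib)
  moreover have "s' > 0"
    using \<open>s \<le> s'\<close> assms(6) by simp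
  ultimately show ?case
    using L_widen[OF ab] by blast
qed

lemma L_ex_orthogonal_of_wide:
  assumes "a \<in> L" "b \<in> L" "ip a a = 1" "ip a b = 1" "ip b b = of_real (1 + s)" "s \<ge> 8"
  shows "\<exists>a\<in>L. \<exists>b\<in>L. ip a b = 0"
proof -
  have "s > 0"
    using assms(6) by simp
  obtain w where w: "\<And>p q. q\<^sup>2 = p - p\<^sup>2 \<Longrightarrow> w p q \<in> L"
    and ww: "\<And>p q p' q'. ip (w p q) (w p' q') = of_real (1 + s * (p * p' + q * q'))"
    using L_circle[OF assms(1-5) \<open>s > 0\<close>] by blast
  \<comment> \<open>The points \<open>w p q\<close> and \<open>w p (- q)\<close> are orthogonal iff \<open>2 p\<^sup>2 - p = - 1 / s\<close>,
      which has a real root iff \<open>s \<ge> 8\<close>.\<close>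
  define u where "u = sqrt (1 - 8 / s)"
  define p where "p = (1 + u) / 4"
  define q where "q = sqrt (p - p\<^sup>2)"
  have u: "u\<^sup>2 = 1 - 8 / s" "0 \<le> u" "u \<le> 1"
    using assms(6) by (auto simp: u_def)
  \<comment> \<open>Since \<open>0 \<le> p \<le> 1\<close>, the number under the root in
    \<open>q\<close> is nonnegative, and the points lie on the circle.\<close>
  have "p * p \<le> p * 1"
    using u by (intro mult_left_mono) (auto simp: p_def)
  then have q: "q * q = p - p\<^sup>2"
    by (simp add: q_def power2_eq_square)
  have "2 * p\<^sup>2 - p = (u\<^sup>2 - 1) / 8"
    by (simp add: p_def power2_eq_square field_simps)
  then have "2 * p\<^sup>2 - p = - 1 / s"
    using u(1) by simp
  moreover have "p * p + q * - q = 2 * p\<^sup>2 - p"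
    using q by (simp add: power2_eq_square)
  ultimately have "1 + s * (p * p + q * - q) = 0"
    using \<open>s > 0\<close> by simp
  then have "ip (w p q) (w p (- q)) = 0"
    unfolding ww by (metis of_real_0)
  moreover have "w p q \<in> L" "w p (- q) \<in> L"
    using q by (auto intro!: w simp: power2_eq_square)
  ultimately show ?thesis
    by blast
qed

text \<open>A non-orthogonal pair is normalised so that \<open>a'\<close> is a unit vector and
  \<open>ip a' b' = 1\<close>; independence gives \<open>s > 0\<close>. Widening until
  \<open>s' \<ge> 8\<close> then produces an orthogonal pair.\<close>

lemma L_eq:
  assumes ab: "a \<in> L" "b \<in> L" and ind: "b \<notin> span {a}"
  shows "X - {0} \<subseteq> L"
proof (cases "ip b a = 0")
  case True
  then show ?thesis
    using L_eq_of_orthogonal[OF ab(2,1)] by blast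
next
  case False
  have "a \<noteq> 0"
    using ab L_subset by auto
  then obtain m where m: "m > 0" "ip a a = of_real m"
    using ip_self_of_real by blast
  define a' where "a' = scale (of_real (1 / sqrt m)) a"
  have "a' \<in> L"
    using m ab(1) by (auto simp: a'_def intro: L_scale)
  have "ip a' a' = of_real (1 / sqrt m * (1 / sqrt m * m))"
    unfolding a'_def ip_scale_left ip_scale_right cj_of_real m(2) by (simp only: of_real_mult)
  also have "1 / sqrt m * (1 / sqrt m * m) = 1"
    using m(1) by (simp add: field_simps)
  finally have aa: "ip a' a' = 1" by simp
  have ba: "ip b a' \<noteq> 0"
    unfolding a'_def ip_scale_right cj_of_real using False m(1) by simp
  define b' where "b' = scale (1 / ip b a') b"
  have "b' \<in> L"
    using ba ab(2) by (auto simp: b'_def intro: L_scale)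
  have "ip b' a' = 1"
    using ba by (simp add: b'_def ip_scale_left)
  then have ab': "ip a' b' = 1"
    using ip_commute[of a' b'] by simp
  have "b' \<noteq> a'"
  proof
    assume "b' = a'"
    then have "b' \<in> span {a}"
      unfolding a'_def by (auto intro: span_scale span_base)
    then have "scale (ip b a') b' \<in> span {a}"
      by (rule span_scale)
    then show False
      using ind ba by (simp add: b'_def)
  qed
  then obtain s where s: "s > 0" "ip (b' - a') (b' - a') = of_real s"
    using ip_self_of_real[of "b' - a'"] by auto
  have "ip b' b' = of_real (1 + s)"
    using s(2) aa ab' \<open>ip b' a' = 1\<close> by (simp add: ip_linear algebra_simps)
  note wide = L_wide[OF \<open>a' \<in> L\<close> \<open>b' \<in> L\<close> aa ab' this s(1)]
  have "s\<^sup>2 / 4 > 0"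
    using s(1) by simp
  then obtain k where "real k * (s\<^sup>2 / 4) > 8"
    using reals_Archimedean3 by blast
  moreover obtain s' a b where "s' \<ge> s + real k * (s\<^sup>2 / 4)" and
    ab: "a \<in> L" "b \<in> L" "ip a a = 1" "ip a b = 1" "ip b b = of_real (1 + s')"
    using wide[of k] by blast
  ultimately have "s' \<ge> 8"
    using s(1) by linarith
  then show ?thesis
    using L_ex_orthogonal_of_wide[OF ab] L_eq_of_orthogonal by blast
qed

end

section \<open>Spines\<close>

lemma mem_spine: "W \<in> spine r \<pi> \<longleftrightarrow> subspace W \<and> dim W = r \<and> \<pi> \<subseteq> W"
  by (auto simp: spine_def grassmannian_def)

lemma spine_mono: "\<pi> \<subseteq> \<sigma> \<Longrightarrow> spine r \<sigma> \<subseteq> spine r \<pi>"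
  by (force simp: mem_spine)

text \<open>Hence every member of the saturated set is full.\<close>

lemma spine_self:
  assumes "\<eta> \<in> grassmannian r"
  shows "spine r \<eta> = {\<eta>}"
proof -
  have "W = \<eta>" if "W \<in> spine r \<eta>" for W
    using that assms subspace_dim_equal[of \<eta> W] by (auto simp: spine_def grassmannian_def)
  then show ?thesis
    using assms by (auto simp: spine_def)
qed

lemma span_insert_subset_iff: "subspace W \<Longrightarrow> span (insert x A) \<subseteq> W \<longleftrightarrow> x \<in> W \<and> A \<subseteq> W"
  using span_superset[of "insert x A"] span_minimal[of "insert x A" W] by blast

lemma ex_orth_extension_vector:
  assumes "subspace A" "subspace W" "A \<subseteq> W" "x \<in> W" "x \<notin> A"
  obtains y where "y \<in> W" "y \<in> orth_compl A" "y \<notin> A" "y \<noteq> 0" "x - y \<in> A"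
proof -
  obtain p where p: "p \<in> A" "x - p \<in> orth_compl A"
    using ex_orth_decomposition[OF assms(1)] by blast
  have "x - p \<in> W"
    using subspace_diff[OF assms(2), of x p] p(1) assms(3,4) by blast
  moreover have "x - p \<notin> A"
    using p(1) assms(1,5) subspace_add[of A "x - p" p] by auto
  moreover have "x - p \<noteq> 0"
    using p(1) assms(5) by auto
  ultimately show thesis
    using that[of "x - p"] p by simp
qed

lemma span_insert_cong_diff:
  assumes "x - y \<in> A"
  shows "span (insert x A) = span (insert y A)"
proof -
  have "x \<in> span (insert y A)"
    using span_add[of "x - y" "insert y A" y] assms by (simp add: span_base)
  moreover have "y \<in> span (insert x A)"
    using span_diff[of x "insert x A" "x - y"] assms by (simp add: span_base)
  ultimately show ?thesis
    using span_superset[of "insert x A"] span_superset[of "insert y A"]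
    unfolding span_eq by blast
qed

text \<open>Take \<open>\<eta> = \<rho> + C\<close>, where \<open>C\<close> is the complement in
  \<open>\<mu>\<close> of the image of \<open>\<rho>\<close>: the projection fixes \<open>C\<close>,
  and the dimensions add up to \<open>r\<close>. If \<open>\<rho>\<close> is full, saturation can
  thus be applied to put \<open>\<mu>\<close> into \<open>S\<close>.\<close>

lemma orth_proj_image_extension:
  assumes \<zeta>: "subspace \<zeta>" and \<rho>: "subspace \<rho>" "\<rho> \<inter> orth_compl \<zeta> \<subseteq> {0}"
    and \<mu>: "\<mu> \<in> grassmannian r" "orth_proj \<zeta> ` \<rho> \<subseteq> \<mu>" "\<mu> \<subseteq> \<zeta>"
  obtains \<eta> where "\<eta> \<in> grassmannian r" "\<rho> \<subseteq> \<eta>" "orth_proj \<zeta> ` \<eta> = \<mu>"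
proof -
  define R where "R = orth_proj \<zeta> ` \<rho>"
  have R: "subspace R" "dim R = dim \<rho>" "R \<subseteq> \<mu>"
    using subspace_orth_proj_image[OF \<zeta> \<rho>(1)] dim_orth_proj_image_eq[OF \<zeta> \<rho>] \<mu>(2)
    by (auto simp: R_def)
  have sub: "subspace \<mu>" "dim \<mu> = r"
    using \<mu>(1) by (auto simp: grassmannian_def)
  define C where "C = \<mu> \<inter> orth_compl R"
  have C: "subspace C" "dim R + dim C = r" "span (R \<union> C) = \<mu>"
    using dim_rel_orth_compl[OF R(1) sub(1) R(3)] span_Un_rel_orth_compl[OF R(1) sub(1) R(3)] sub
    by (simp_all add: C_def subspace_inter)
  define \<eta> where "\<eta> = span (\<rho> \<union> C)"
  have "orth_proj \<zeta> ` C = C"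
    using orth_proj_ident[OF \<zeta>] \<mu>(3) by (force simp: C_def)
  then have img: "orth_proj \<zeta> ` \<eta> = \<mu>"
    using C(3) by (simp add: \<eta>_def orth_proj_image_span[OF \<zeta>] image_Un R_def)
  have "r \<le> dim \<eta>"
    using dim_orth_proj_image_le[OF \<zeta>, of \<eta>] img sub(2) by simp
  moreover have "dim \<eta> \<le> r"
    using dim_subspace_span_Un[OF \<rho>(1) C(1)] C(2) R(2) by (simp add: \<eta>_def)
  ultimately have "\<eta> \<in> grassmannian r"
    by (simp add: grassmannian_def \<eta>_def)
  then show thesis
    using that img by (auto simp: \<eta>_def intro: span_base)
qed

section \<open>Unions of distal spines are saturated\<close>

text \<open>\<open>\<pi> \<inter> orth_compl \<pi>'\<close> and \<open>\<pi>'\<close> are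
  independent, and by distality their dimensions add up to more than \<open>d\<close>.\<close>

lemma distal_separates:
  assumes "distal d \<pi> \<pi>'" "subspace W" "\<pi> \<subseteq> W" "\<pi>' \<subseteq> W"
  shows "dim W > d"
proof -
  define A where "A = \<pi> \<inter> orth_compl \<pi>'"
  have sub: "subspace \<pi>" "subspace \<pi>'" and d: "dim A > d - dim \<pi>'" "dim \<pi>' < d"
    using assms(1) by (auto simp: distal_def A_def)
  then have "subspace A"
    by (simp add: A_def subspace_inter)
  have "A \<inter> \<pi>' \<subseteq> {0}"
    using Int_orth_compl_trivial by (auto simp: A_def)
  then have "dim (A \<inter> \<pi>') = 0"
    by (simp add: dim_eq_0)
  then have "dim (span (A \<union> \<pi>')) > d"
    using dim_subspace_span_Un[OF \<open>subspace A\<close> sub(2)] d by simp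
  moreover have "span (A \<union> \<pi>') \<subseteq> W"
    using assms by (intro span_minimal) (auto simp: A_def)
  ultimately show ?thesis
    using dim_subset[of "span (A \<union> \<pi>')" W] by simp
qed

text \<open>Projection to \<open>\<zeta> \<supseteq> \<pi>\<close> maps
  \<open>A = \<pi>' \<inter> orth_compl \<pi>\<close> into
  \<open>\<zeta> \<inter> orth_compl \<pi>\<close>, which has dimension
  \<open>d - dim \<pi> < dim A\<close>. So it kills a nonzero vector of \<open>\<eta>'\<close>, and
  the image has dimension below \<open>r\<close>.\<close>

lemma distal_no_tau:
  assumes dist: "distal d \<pi>' \<pi>" and \<eta>: "\<pi> \<subseteq> \<eta>"
    and \<eta>': "\<eta>' \<in> grassmannian r" "\<pi>' \<subseteq> \<eta>'" and \<eta>'': "\<eta>'' \<in> grassmannian r"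
  shows "\<not> tau d \<eta> \<eta>' \<eta>''"
proof
  assume "tau d \<eta> \<eta>' \<eta>''"
  then obtain \<zeta> where \<zeta>: "subspace \<zeta>" "dim \<zeta> = d" "\<eta> \<subseteq> \<zeta>" "\<eta>'' = orth_proj \<zeta> ` \<eta>'"
    by (auto simp: tau_def grassmannian_def)
  define A where "A = \<pi>' \<inter> orth_compl \<pi>"
  have sub: "subspace \<pi>" "subspace \<pi>'" "subspace A" and d: "dim A > d - dim \<pi>"
    using dist by (auto simp: distal_def A_def subspace_inter)
  have "orth_proj \<zeta> x \<in> \<zeta> \<inter> orth_compl \<pi>" if "x \<in> A" for x
  proof -
    have "x - orth_proj \<zeta> x \<in> orth_compl \<pi>"
      using diff_orth_proj[OF \<zeta>(1), of x] \<zeta>(3) \<eta> by (auto simp: orth_compl_def)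
    then show ?thesis
      using subspace_diff[OF subspace_orth_compl, of x \<pi> "x - orth_proj \<zeta> x"] that
        orth_proj_in[OF \<zeta>(1)] by (auto simp: A_def)
  qed
  then have "dim (orth_proj \<zeta> ` A) \<le> dim (\<zeta> \<inter> orth_compl \<pi>)"
    by (intro dim_subset) blast
  also have "\<dots> = d - dim \<pi>"
    using dim_rel_orth_compl[OF sub(1) \<zeta>(1) subset_trans[OF \<eta> \<zeta>(3)]] \<zeta>(2) by simp
  finally have "\<not> A \<inter> orth_compl \<zeta> \<subseteq> {0}"
    using dim_orth_proj_image_eq[OF \<zeta>(1) sub(3)] d by auto
  then obtain x where "x \<in> A" "x \<in> orth_compl \<zeta>" "x \<noteq> 0"
    by blast
  then have "dim (orth_proj \<zeta> ` \<eta>') < dim \<eta>'"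
    using \<eta>' by (intro dim_orth_proj_image_less[OF \<zeta>(1)]) (auto simp: grassmannian_def A_def)
  then show False
    using \<eta>'(1) \<eta>'' \<zeta>(4) by (simp add: grassmannian_def)
qed

text \<open>By \<open>distal_no_tau\<close> both arguments of \<open>tau\<close> lie in the same
  spine; its \<open>\<pi> i\<close> is contained in \<open>\<zeta>\<close>, hence fixed by the
  projection.\<close>

lemma spine_decomposition_imp_saturated:
  assumes "spine_decomposition r d S I \<pi>"
  shows "tau_saturated r d S"
  unfolding tau_saturated_def
proof (intro ballI impI)
  fix \<eta> \<eta>' \<eta>'' assume \<eta>: "\<eta> \<in> S" "\<eta>' \<in> S" and \<eta>'': "\<eta>'' \<in> grassmannian r"
    and tau: "tau d \<eta> \<eta>' \<eta>''"
  obtain i j where ij: "i \<in> I" "j \<in> I" "\<eta> \<in> spine r (\<pi> i)" "\<eta>' \<in> spine r (\<pi> j)"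
    using assms \<eta> by (auto simp: spine_decomposition_def)
  have "i = j"
  proof (rule ccontr)
    assume "i \<noteq> j"
    then have "distal d (\<pi> j) (\<pi> i)"
      using assms ij by (auto simp: spine_decomposition_def)
    then show False
      using distal_no_tau[of d "\<pi> j" "\<pi> i" \<eta> \<eta>' r \<eta>''] ij tau \<eta>''
      by (auto simp: mem_spine grassmannian_def)
  qed
  obtain \<zeta> where \<zeta>: "subspace \<zeta>" "\<eta> \<subseteq> \<zeta>" "\<eta>'' = orth_proj \<zeta> ` \<eta>'"
    using tau by (auto simp: tau_def grassmannian_def)
  have "\<pi> i \<subseteq> \<eta>''"
  proof
    fix x assume "x \<in> \<pi> i"
    then have "x \<in> \<zeta>" "x \<in> \<eta>'"
      using ij \<zeta> \<open>i = j\<close> by (auto simp: mem_spine)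
    then have "orth_proj \<zeta> x \<in> \<eta>''"
      unfolding \<zeta>(3) by blast
    moreover have "orth_proj \<zeta> x = x"
      using orth_proj_ident[OF \<zeta>(1) \<open>x \<in> \<zeta>\<close>] .
    ultimately show "x \<in> \<eta>''" by simp
  qed
  then have "\<eta>'' \<in> spine r (\<pi> i)"
    using \<eta>'' by (simp add: spine_def)
  then show "\<eta>'' \<in> S"
    using assms ij(1) by (auto simp: spine_decomposition_def)
qed

section \<open>Full subspaces of a saturated set\<close>

context
  fixes S :: "'v set set" and r d :: nat
  assumes r_pos: "1 \<le> r" and r_less: "r < d" and d_less: "d < dim UNIV"
    and S_subset: "S \<subseteq> grassmannian r" and saturated: "tau_saturated r d S"
begin

lemma saturatedD:
  assumes "\<eta> \<in> S" "\<eta>' \<in> S" "\<eta>'' \<in> grassmannian r" "subspace \<zeta>" "dim \<zeta> = d" "\<eta> \<subseteq> \<zeta>"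
    "\<eta>'' = orth_proj \<zeta> ` \<eta>'"
  shows "\<eta>'' \<in> S"
  using saturated assms unfolding tau_saturated_def tau_def grassmannian_def by blast

text \<open>Instance of \<open>L_eq\<close> in the complement of \<open>\<kappa>\<close>, where
  members of the spine of \<open>\<kappa>\<close> correspond to lines.\<close>

lemma adjacent_imp_spine:
  assumes \<kappa>: "subspace \<kappa>" "dim \<kappa> + 1 = r" and x: "x \<notin> \<kappa>" and y: "y \<notin> span (insert x \<kappa>)"
    and S: "span (insert x \<kappa>) \<in> S" "span (insert y \<kappa>) \<in> S"
  shows "spine r \<kappa> \<subseteq> S"
proof -
  define X where "X = orth_compl \<kappa>"
  define L where "L = {a \<in> X - {0}. span (insert a \<kappa>) \<in> S}"
  have notin: "a \<notin> \<kappa>" if "a \<in> X - {0}" for a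
    using that Int_orth_compl_trivial by (auto simp: X_def)
  have "subspace X"
    by (simp add: X_def)
  moreover have "L \<subseteq> X - {0}"
    by (auto simp: L_def)
  moreover have "scale c a \<in> L" if "a \<in> L" "c \<noteq> 0" for a c
  proof -
    have "span (insert (scale c a) \<kappa>) = span (insert a \<kappa>)"
    proof
      show "span (insert (scale c a) \<kappa>) \<subseteq> span (insert a \<kappa>)"
        by (intro span_minimal) (auto intro: span_base span_scale)
      have "scale (1 / c) (scale c a) \<in> span (insert (scale c a) \<kappa>)"
        by (intro span_scale span_base) simp
      then have "a \<in> span (insert (scale c a) \<kappa>)"
        using that(2) by simp
      then show "span (insert a \<kappa>) \<subseteq> span (insert (scale c a) \<kappa>)"
        by (intro span_minimal) (auto intro: span_base)
    qed
    then show ?thesis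
      using that \<open>subspace X\<close> by (auto simp: L_def subspace_scale)
  qed
  moreover have "w \<in> L" if ab: "a \<in> L" "b \<in> L" and w: "w \<in> X" "w \<noteq> 0"
    and perp: "ip (b - w) a = 0" "ip (b - w) w = 0" for a b w
  proof (cases "b = w")
    case False
    \<comment> \<open>A \<open>d\<close>-dimensional \<open>\<zeta>\<close> between
      \<open>\<kappa> + a + w\<close> and the hyperplane orthogonal to \<open>b - w\<close> projects
      \<open>b\<close> to \<open>w\<close>. It exists because \<open>r + 1 \<le> d\<close> and
      \<open>d\<close> is less than the dimension of the whole space.\<close>
    define Z where "Z = orth_compl {b - w}"
    have "subspace Z"
      by (simp add: Z_def)
    have "dim (span {b - w}) = 1"
      using False by simp
    then have "dim Z + 1 = dim UNIV"
      using dim_orth_compl[of "span {b - w}"] by (simp add: Z_def)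
    then have "d \<le> dim Z"
      using d_less by simp
    have bw: "b - w \<in> X"
      using ab(2) w \<open>subspace X\<close> by (auto simp: L_def intro: subspace_diff)
    define U where "U = span (insert a (insert w \<kappa>))"
    have "insert a (insert w \<kappa>) \<subseteq> Z"
      using perp bw ip_eq_0_commute by (auto simp: Z_def X_def orth_compl_def)
    then have "U \<subseteq> Z"
      unfolding U_def using \<open>subspace Z\<close> by (rule span_minimal)
    moreover have "dim U \<le> d"
      using \<kappa> r_less by (simp add: U_def dim_insert)
    ultimately obtain \<zeta> where \<zeta>: "subspace \<zeta>" "U \<subseteq> \<zeta>" "\<zeta> \<subseteq> Z" "dim \<zeta> = d"
      using subspace_between[of U Z d] \<open>subspace Z\<close> \<open>d \<le> dim Z\<close> by (auto simp: U_def)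
    have in\<zeta>: "a \<in> \<zeta>" "w \<in> \<zeta>" "\<kappa> \<subseteq> \<zeta>"
      using \<zeta>(2) span_superset[of "insert a (insert w \<kappa>)"] by (auto simp: U_def)
    have "b - w \<in> orth_compl \<zeta>"
      using \<zeta>(3) ip_eq_0_commute by (auto simp: Z_def orth_compl_def)
    then have "orth_proj \<zeta> b = w"
      using orth_proj_unique[OF \<zeta>(1) in\<zeta>(2)] by simp
    moreover have "orth_proj \<zeta> ` \<kappa> = \<kappa>"
      using orth_proj_ident[OF \<zeta>(1)] in\<zeta>(3) by force
    ultimately have "span (insert w \<kappa>) = orth_proj \<zeta> ` span (insert b \<kappa>)"
      by (simp add: orth_proj_image_span[OF \<zeta>(1)])
    moreover have "span (insert w \<kappa>) \<in> grassmannian r"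
      using dim_span_insert_notin[OF \<kappa>(1) notin[of w]] w \<kappa>(2) by (simp add: grassmannian_def)
    moreover have "span (insert a \<kappa>) \<subseteq> \<zeta>"
      using \<zeta>(1) in\<zeta> by (simp add: span_insert_subset_iff)
    ultimately have "span (insert w \<kappa>) \<in> S"
      using saturatedD[OF _ _ _ \<zeta>(1,4)] ab by (auto simp: L_def)
    then show ?thesis
      using w by (simp add: L_def)
  qed (use ab in auto)
  moreover have "\<exists>c\<in>X. c \<noteq> 0 \<and> ip c a = 0 \<and> ip c b = 0" if "a \<in> X" "b \<in> X" for a b
  proof -
    define U where "U = span (insert a (insert b \<kappa>))"
    have "dim U < dim UNIV"
      using \<kappa>(2) r_less d_less by (simp add: U_def dim_insert)
    then have "dim (orth_compl U) \<noteq> 0"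
      using dim_orth_compl[of U] by (simp add: U_def)
    then obtain c where "c \<in> orth_compl U" "c \<noteq> 0"
      unfolding dim_eq_0 by blast
    then have "c \<in> X" "ip c a = 0" "ip c b = 0" "c \<noteq> 0"
      unfolding U_def orth_compl_span by (auto simp: X_def orth_compl_def)
    then show ?thesis by blast
  qed
  moreover obtain a where a: "a \<in> X" "a \<noteq> 0" "x - a \<in> \<kappa>"
    using ex_orth_extension_vector[OF \<kappa>(1) subspace_UNIV _ _ x] by (auto simp: X_def)
  have "y \<notin> \<kappa>"
    using y by (auto intro: span_base)
  then obtain b where b: "b \<in> X" "b \<noteq> 0" "y - b \<in> \<kappa>"
    using ex_orth_extension_vector[OF \<kappa>(1) subspace_UNIV, of y] by (auto simp: X_def)
  have "a \<in> L" "b \<in> L"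
    using a b S span_insert_cong_diff by (auto simp: L_def)
  moreover have "b \<notin> span {a}"
  proof
    assume "b \<in> span {a}"
    then have "b \<in> span (insert a \<kappa>)"
      using span_mono[of "{a}" "insert a \<kappa>"] by auto
    then have "(y - b) + b \<in> span (insert a \<kappa>)"
      using b(3) by (intro span_add) (auto intro: span_base)
    then show False
      using y span_insert_cong_diff[OF a(3)] by simp
  qed
  ultimately have all: "X - {0} \<subseteq> L"
    by (rule L_eq)
  show ?thesis
  proof
    fix W assume W: "W \<in> spine r \<kappa>"
    then have W': "subspace W" "dim W = dim \<kappa> + 1" "\<kappa> \<subseteq> W"
      using \<kappa>(2) by (auto simp: mem_spine)
    then obtain v where "v \<in> W" "v \<notin> \<kappa>"
      by (metis Suc_eq_plus1 n_not_Suc_n subsetI subset_antisym)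
    then obtain c where c: "c \<in> W" "c \<in> X" "c \<notin> \<kappa>" "c \<noteq> 0"
      using ex_orth_extension_vector[OF \<kappa>(1) W'(1,3)] by (metis X_def)
    then have "W = span (insert c \<kappa>)"
      using W' \<kappa>(1) by (intro span_insert_eq_subspace) auto
    then show "W \<in> S"
      using all c by (auto simp: L_def)
  qed
qed

text \<open>If \<open>W\<close> contains neither \<open>x\<close> nor \<open>y\<close>, choose a
  hyperplane \<open>\<beta> \<supseteq> \<kappa>\<close> of \<open>W\<close> with \<open>y\<close>
  outside \<open>\<beta> + x\<close>. Then \<open>\<beta> + x\<close> and \<open>\<beta> + y\<close>
  are adjacent members of \<open>S\<close>, so \<open>\<beta>\<close> is full and \<open>W\<close>
  is in its spine.\<close>

lemma adjacent_spines_imp_spine: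
  assumes \<kappa>: "subspace \<kappa>" "dim \<kappa> < r" and x: "x \<notin> \<kappa>" and y: "y \<notin> span (insert x \<kappa>)"
    and S: "spine r (span (insert x \<kappa>)) \<subseteq> S" "spine r (span (insert y \<kappa>)) \<subseteq> S"
  shows "spine r \<kappa> \<subseteq> S"
proof
  fix W assume "W \<in> spine r \<kappa>"
  then have W: "subspace W" "dim W = r" "\<kappa> \<subseteq> W"
    by (auto simp: mem_spine)
  show "W \<in> S"
  proof (cases "x \<in> W \<or> y \<in> W")
    case True
    then have "W \<in> spine r (span (insert x \<kappa>)) \<or> W \<in> spine r (span (insert y \<kappa>))"
      using W by (simp add: mem_spine span_insert_subset_iff)
    then show ?thesis
      using S by blast
  next
    case False
    have "dim \<kappa> \<le> r - 1"
      using \<kappa>(2) by simp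
    have "\<exists>\<beta>. subspace \<beta> \<and> \<kappa> \<subseteq> \<beta> \<and> \<beta> \<subseteq> W \<and> dim \<beta> = r - 1 \<and> y \<notin> span (insert x \<beta>)"
    proof (cases "y \<in> span (insert x W)")
      case False
      obtain \<beta> where \<beta>: "subspace \<beta>" "\<kappa> \<subseteq> \<beta>" "\<beta> \<subseteq> W" "dim \<beta> = r - 1"
        using subspace_between[OF \<kappa>(1) W(1,3) \<open>dim \<kappa> \<le> r - 1\<close>] W(2) by auto
      then have "y \<notin> span (insert x \<beta>)"
        using False span_mono[of "insert x \<beta>" "insert x W"] by auto
      then show ?thesis
        using \<beta> by blast
    next
      case True
      \<comment> \<open>As \<open>x\<close> is not in \<open>W\<close>, only this \<open>c\<close>
        brings \<open>y - c x\<close> into \<open>W\<close>. Hence \<open>y\<close> stays outside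
        \<open>\<beta> + x\<close> as soon as \<open>\<beta>\<close> avoids this one vector.\<close>
      then obtain c where c: "y - scale c x \<in> W"
        using W(1) by (auto simp: span_breakdown_eq span_eq_iff[THEN iffD2])
      have "y - scale c x \<notin> \<kappa>"
        using y by (auto simp: span_breakdown_eq intro: span_base)
      then obtain \<beta> where \<beta>: "subspace \<beta>" "\<kappa> \<subseteq> \<beta>" "\<beta> \<subseteq> W" "y - scale c x \<notin> \<beta>" "dim \<beta> = r - 1"
        using subspace_between_avoiding[OF \<kappa>(1) W(1,3) c _ \<open>dim \<kappa> \<le> r - 1\<close>] W(2) r_pos by auto
      have "y \<notin> span (insert x \<beta>)"
      proof
        assume "y \<in> span (insert x \<beta>)"
        then obtain c' where c': "y - scale c' x \<in> \<beta>"
          using \<beta>(1) by (auto simp: span_breakdown_eq span_eq_iff[THEN iffD2])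
        then have "(y - scale c x) - (y - scale c' x) \<in> W"
          using \<beta>(3) by (intro subspace_diff[OF W(1) c]) blast
        then have "scale (c' - c) x \<in> W"
          by (simp add: scale_left_diff_distrib)
        then have "scale (1 / (c' - c)) (scale (c' - c) x) \<in> W"
          using W(1) subspace_scale by blast
        then have "c' = c"
          using False by (cases "c' = c") auto
        then show False
          using c' \<beta>(4) by simp
      qed
      then show ?thesis
        using \<beta> by blast
    qed
    then obtain \<beta> where \<beta>: "subspace \<beta>" "\<kappa> \<subseteq> \<beta>" "\<beta> \<subseteq> W" "dim \<beta> = r - 1" "y \<notin> span (insert x \<beta>)"
      by blast
    have in_S: "span (insert z \<beta>) \<in> S" if "spine r (span (insert z \<kappa>)) \<subseteq> S" "z \<notin> \<beta>" for z
    proof -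
      have "span (insert z \<kappa>) \<subseteq> span (insert z \<beta>)"
        using \<beta>(2) by (intro span_mono) auto
      then have "span (insert z \<beta>) \<in> spine r (span (insert z \<kappa>))"
        using dim_span_insert_notin[OF \<beta>(1) that(2)] \<beta>(4) r_pos by (simp add: mem_spine)
      then show ?thesis
        using that(1) by blast
    qed
    have "x \<notin> \<beta>" "y \<notin> \<beta>"
      using False \<beta>(3) by auto
    then have "spine r \<beta> \<subseteq> S"
      using \<beta> r_pos S in_S by (intro adjacent_imp_spine[of \<beta> x y]) auto
    then show ?thesis
      using W \<beta>(3) by (auto simp: mem_spine)
  qed
qed

text \<open>Shrink \<open>\<sigma>\<close> to \<open>\<kappa>\<close> through hyperplanes
  \<open>\<tau> \<supseteq> \<kappa>\<close>: \<open>\<tau> + x = \<sigma>\<close> is full,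
  \<open>\<tau> + y\<close> is full because it contains \<open>\<kappa> + y\<close>, so
  \<open>\<tau>\<close> is full by the previous lemma.\<close>

lemma spine_Int_hyperplane:
  assumes \<kappa>: "subspace \<kappa>" "dim \<kappa> < r" and \<sigma>: "subspace \<sigma>" "dim \<sigma> \<le> r" "\<kappa> \<subseteq> \<sigma>" and y: "y \<notin> \<sigma>"
    and S: "spine r (span (insert y \<kappa>)) \<subseteq> S" "spine r \<sigma> \<subseteq> S"
  shows "spine r \<kappa> \<subseteq> S"
  using \<sigma> y S(2)
proof (induction "dim \<sigma>" arbitrary: \<sigma> rule: less_induct)
  case less
  show ?case
  proof (cases "\<sigma> = \<kappa>")
    case False
    then obtain x where x: "x \<in> \<sigma>" "x \<notin> \<kappa>"
      using less.prems(3) by blast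
    have "dim \<kappa> < dim \<sigma>"
      using False less.prems \<kappa>(1) by (intro subspace_dim_less) auto
    then have "dim \<kappa> \<le> dim \<sigma> - 1" "dim \<sigma> - 1 < dim \<sigma>"
      by simp_all
    then obtain \<tau> where \<tau>: "subspace \<tau>" "\<kappa> \<subseteq> \<tau>" "\<tau> \<subseteq> \<sigma>" "x \<notin> \<tau>" "dim \<tau> = dim \<sigma> - 1"
      using subspace_between_avoiding[OF \<kappa>(1) less.prems(1,3) x] by metis
    have \<sigma>_eq: "\<sigma> = span (insert x \<tau>)"
      using \<tau> less.prems(1) x \<open>dim \<kappa> < dim \<sigma>\<close> by (intro span_insert_eq_subspace) auto
    have "spine r (span (insert y \<tau>)) \<subseteq> spine r (span (insert y \<kappa>))"
      using \<tau>(2) by (intro spine_mono span_mono) auto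
    then have "spine r \<tau> \<subseteq> S"
      using \<tau> \<sigma>_eq less.prems \<open>dim \<kappa> < dim \<sigma>\<close> S(1)
      by (intro adjacent_spines_imp_spine[of \<tau> x y]) auto
    then show ?thesis
    proof (rule less.hyps[rotated 5])
      show "dim \<tau> < dim \<sigma>" "dim \<tau> \<le> r" "y \<notin> \<tau>"
        using \<tau> less.prems(2,4) \<open>dim \<kappa> < dim \<sigma>\<close> by auto
    qed (use \<tau> in auto)
  qed (use less.prems in auto)
qed

text \<open>Project \<open>\<pi>\<close> to a space \<open>\<zeta>\<close> that contains \<open>\<eta>\<close> and a hyperplane \<open>\<sigma> \<supseteq> \<pi> \<inter> \<eta>\<close> of \<open>\<pi>\<close>, but
  neither contains nor is orthogonal to the rest of \<open>\<pi>\<close>: the image meets \<open>\<pi>\<close> exactly in \<open>\<sigma>\<close>.\<close>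

lemma reduce_spine_near:
  assumes \<pi>: "subspace \<pi>" "dim \<pi> \<le> r" "spine r \<pi> \<subseteq> S" and \<eta>: "\<eta> \<in> S"
    and near: "dim (span (\<pi> \<union> \<eta>)) \<le> d" and nsub: "\<not> \<pi> \<subseteq> \<eta>"
  shows "\<exists>\<sigma>. subspace \<sigma> \<and> \<sigma> \<subset> \<pi> \<and> spine r \<sigma> \<subseteq> S"
proof -
  have \<eta>': "subspace \<eta>" "dim \<eta> = r"
    using \<eta> S_subset by (auto simp: grassmannian_def)
  obtain x0 where x0: "x0 \<in> \<pi>" "x0 \<notin> \<pi> \<inter> \<eta>"
    using nsub by blast
  have "dim (\<pi> \<inter> \<eta>) < dim \<pi>"
    using \<pi>(1) \<eta>'(1) nsub by (intro subspace_dim_less) (auto intro: subspace_inter)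
  then have "dim (\<pi> \<inter> \<eta>) \<le> dim \<pi> - 1" "dim \<pi> - 1 < dim \<pi>"
    by simp_all
  then obtain \<sigma> where \<sigma>: "subspace \<sigma>" "\<pi> \<inter> \<eta> \<subseteq> \<sigma>" "\<sigma> \<subseteq> \<pi>" "x0 \<notin> \<sigma>" "dim \<sigma> = dim \<pi> - 1"
    using subspace_between_avoiding[OF subspace_inter[OF \<pi>(1) \<eta>'(1)] \<pi>(1) Int_lower1 x0] by metis
  obtain x where x: "x \<in> \<pi>" "x \<in> orth_compl \<sigma>" "x \<notin> \<sigma>" "x \<noteq> 0"
    using ex_orth_extension_vector[OF \<sigma>(1) \<pi>(1) \<sigma>(3) x0(1) \<sigma>(4)] by metis
  have \<pi>_eq: "\<pi> = span (insert x \<sigma>)"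
    using \<sigma> \<pi>(1) x \<open>dim (\<pi> \<inter> \<eta>) < dim \<pi>\<close> by (intro span_insert_eq_subspace) auto
  define \<omega> where "\<omega> = span (\<sigma> \<union> \<eta>)"
  \<comment> \<open>Otherwise \<open>x = p + e\<close> with \<open>p\<close> in
    \<open>\<sigma>\<close> and \<open>e\<close> in
    \<open>\<pi> \<inter> \<eta> \<subseteq> \<sigma>\<close>, which puts \<open>x\<close> into
    \<open>\<sigma>\<close>.\<close>
  have "x \<notin> \<omega>"
  proof
    assume "x \<in> \<omega>"
    then obtain p e where pe: "p \<in> \<sigma>" "e \<in> \<eta>" "x = p + e"
      unfolding \<omega>_def span_Un using \<sigma>(1) \<eta>'(1) by (auto simp: span_eq_iff[THEN iffD2])
    then have "x - p \<in> \<pi>"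
      using x(1) \<sigma>(3) subspace_diff[OF \<pi>(1), of x p] by blast
    then have "e \<in> \<sigma>"
      using pe \<sigma>(2) by auto
    then show False
      using pe x(3) subspace_add[OF \<sigma>(1)] by blast
  qed
  have "span (insert x \<omega>) \<subseteq> span (\<pi> \<union> \<eta>)"
    using x(1) \<sigma>(3) unfolding \<omega>_def
    by (intro span_minimal) (auto intro: span_base span_mono[THEN subsetD, of "\<sigma> \<union> \<eta>"])
  then have dim_x\<omega>: "dim (span (insert x \<omega>)) \<le> d"
    using near dim_subset by (metis dim_span order_trans)
  then have "dim \<omega> + 1 \<le> d"
    using dim_span_insert_notin[of \<omega> x] \<open>x \<notin> \<omega>\<close> by (simp add: \<omega>_def)
  \<comment> \<open>The vector \<open>u\<close> will keep the projection of \<open>x\<close>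
    nonzero. If \<open>x\<close> is orthogonal to \<open>\<omega>\<close>, adjoin
    \<open>u = x + y\<close> with \<open>y \<noteq> 0\<close> orthogonal to \<open>\<omega>\<close>
    and \<open>x\<close>; the spare dimension in \<open>dim \<omega> + 1 \<le> d\<close> pays for
    it.\<close>
  have "\<exists>\<omega>' u. subspace \<omega>' \<and> \<omega> \<subseteq> \<omega>' \<and> dim \<omega>' \<le> d \<and> x \<notin> \<omega>' \<and> u \<in> \<omega>' \<and> ip x u \<noteq> 0"
  proof (cases "x \<in> orth_compl \<omega>")
    case False
    then show ?thesis
      using \<open>x \<notin> \<omega>\<close> \<open>dim \<omega> + 1 \<le> d\<close> by (intro exI[of _ \<omega>]) (auto simp: \<omega>_def orth_compl_def)
  next
    case True
    have "dim (orth_compl (span (insert x \<omega>))) \<noteq> 0"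
      using dim_orth_compl[of "span (insert x \<omega>)"] dim_x\<omega> d_less by simp
    then obtain y where "y \<in> orth_compl (insert x \<omega>)" "y \<noteq> 0"
      unfolding orth_compl_span dim_eq_0 by blast
    then have y: "y \<in> orth_compl \<omega>" "ip y x = 0" "ip x y = 0" "y \<noteq> 0"
      using ip_eq_0_commute by (auto simp: orth_compl_def)
    have "x \<notin> span (insert (x + y) \<omega>)"
    proof
      assume "x \<in> span (insert (x + y) \<omega>)"
      then obtain k where k: "x - scale k (x + y) \<in> \<omega>"
        by (auto simp: span_breakdown_eq \<omega>_def span_span)
      then have "ip y (x - scale k (x + y)) = 0"
        using y(1) by (auto simp: orth_compl_def)
      then have "cj k = 0"
        using y by (simp add: ip_linear)
      \<comment> \<open>The factor \<open>cj k\<close> appears in this square, so definiteness makes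
        \<open>k (x + y)\<close> vanish.\<close>
      then have "ip (scale k (x + y)) (scale k (x + y)) = 0"
        unfolding ip_scale_right by simp
      then have "scale k (x + y) = 0"
        by (rule ip_definite)
      then have "x \<in> \<omega>"
        using k by (metis diff_zero)
      then show False
        using \<open>x \<notin> \<omega>\<close> by simp
    qed
    moreover have "dim (span (insert (x + y) \<omega>)) \<le> d"
      using \<open>dim \<omega> + 1 \<le> d\<close> by (simp add: dim_insert)
    moreover have "ip x (x + y) \<noteq> 0"
      using x(4) y by (simp add: ip_linear)
    ultimately show ?thesis
      by (intro exI[of _ "span (insert (x + y) \<omega>)"] exI[of _ "x + y"]) (auto intro: span_base)
  qed
  then obtain \<omega>' u where \<omega>': "subspace \<omega>'" "\<omega> \<subseteq> \<omega>'" "dim \<omega>' \<le> d" "x \<notin> \<omega>'"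
    and u: "u \<in> \<omega>'" "ip x u \<noteq> 0"
    by blast
  obtain \<zeta> where \<zeta>: "subspace \<zeta>" "\<omega>' \<subseteq> \<zeta>" "x \<notin> \<zeta>" "dim \<zeta> = d"
    using subspace_between_avoiding[OF \<omega>'(1) subspace_UNIV _ _ \<omega>'(4,3)] d_less by auto
  have sub: "\<sigma> \<subseteq> \<zeta>" "\<eta> \<subseteq> \<zeta>"
    using \<zeta>(2) \<omega>'(2) span_superset[of "\<sigma> \<union> \<eta>"] by (auto simp: \<omega>_def)
  \<comment> \<open>A vector of \<open>\<pi>\<close> orthogonal to
    \<open>\<zeta> \<supseteq> \<sigma>\<close> is a multiple of \<open>x\<close>, and
    \<open>u\<close> in \<open>\<zeta>\<close> forces the coefficient to be 0.\<close>
  have inj: "\<pi> \<inter> orth_compl \<zeta> \<subseteq> {0}"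
  proof
    fix v assume v: "v \<in> \<pi> \<inter> orth_compl \<zeta>"
    then obtain k where "v - scale k x \<in> \<sigma>"
      unfolding \<pi>_eq using \<sigma>(1) by (auto simp: span_breakdown_eq span_eq_iff[THEN iffD2])
    moreover have "v - scale k x \<in> orth_compl \<sigma>"
      using v x(2) sub(1) by (auto simp: orth_compl_def ip_linear)
    ultimately have v_eq: "v = scale k x"
      using Int_orth_compl_trivial by fastforce
    moreover have "ip v u = 0"
      using v u(1) \<zeta>(2) by (auto simp: orth_compl_def)
    ultimately have "k = 0"
      using u(2) by (simp add: ip_linear)
    then show "v \<in> {0}"
      using v_eq by simp
  qed
  have img: "subspace (orth_proj \<zeta> ` \<pi>)" "orth_proj \<zeta> ` \<pi> \<subseteq> \<zeta>" "dim (orth_proj \<zeta> ` \<pi>) \<le> r"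
    using subspace_orth_proj_image[OF \<zeta>(1) \<pi>(1)] orth_proj_in[OF \<zeta>(1)]
      dim_orth_proj_image_le[OF \<zeta>(1), of \<pi>] \<pi>(2) by auto
  then obtain \<mu> where \<mu>: "subspace \<mu>" "orth_proj \<zeta> ` \<pi> \<subseteq> \<mu>" "\<mu> \<subseteq> \<zeta>" "dim \<mu> = r"
    using subspace_between[OF img(1) \<zeta>(1) img(2), of r] \<zeta>(4) r_less by auto
  then have \<mu>_gr: "\<mu> \<in> grassmannian r"
    by (simp add: grassmannian_def)
  obtain \<eta>' where "\<eta>' \<in> grassmannian r" "\<pi> \<subseteq> \<eta>'" "orth_proj \<zeta> ` \<eta>' = \<mu>"
    using orth_proj_image_extension[OF \<zeta>(1) \<pi>(1) inj \<mu>_gr \<mu>(2,3)] by blast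
  moreover from this have "\<eta>' \<in> S"
    using \<pi>(3) by (auto simp: spine_def)
  ultimately have "\<mu> \<in> S"
    using saturatedD[OF \<eta> _ \<mu>_gr \<zeta>(1,4) sub(2)] by blast
  have "\<sigma> \<subseteq> \<mu>"
  proof
    fix v assume "v \<in> \<sigma>"
    then have "orth_proj \<zeta> v = v" "v \<in> \<pi>"
      using sub(1) \<sigma>(3) orth_proj_ident[OF \<zeta>(1)] by auto
    then show "v \<in> \<mu>"
      using \<mu>(2) by force
  qed
  have "spine r \<sigma> \<subseteq> S"
  proof (rule spine_Int_hyperplane[where \<sigma> = \<mu> and y = x])
    show "dim \<sigma> < r"
      using \<sigma>(5) \<pi>(2) \<open>dim (\<pi> \<inter> \<eta>) < dim \<pi>\<close> by simp
    show "x \<notin> \<mu>"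
      using \<mu>(3) \<zeta>(3) by blast
    show "spine r \<mu> \<subseteq> S"
      using spine_self[OF \<mu>_gr] \<open>\<mu> \<in> S\<close> by simp
  qed (use \<sigma> \<mu> \<pi> \<pi>_eq \<open>\<sigma> \<subseteq> \<mu>\<close> in auto)
  then show ?thesis
    using \<sigma>(1,3,4) x0(1) by blast
qed

text \<open>The projection to a \<open>\<zeta> \<supseteq> \<pi> + A + x\<close> is injective on
  \<open>\<pi>'\<close>, since a vector of \<open>\<pi>'\<close> orthogonal to
  \<open>\<zeta>\<close> lies in \<open>A \<subseteq> \<zeta>\<close>. Extending the image to some
  \<open>\<mu>\<close> in \<open>S\<close> that lies in \<open>\<zeta>\<close> but does not contain
  \<open>\<pi>\<close> leads to \<open>reduce_spine_near\<close>.\<close>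

lemma reduce_spine:
  assumes \<pi>: "subspace \<pi>" "dim \<pi> \<le> r" "spine r \<pi> \<subseteq> S"
    and \<pi>': "subspace \<pi>'" "spine r \<pi>' \<subseteq> S"
    and le: "dim \<pi>' \<le> dim \<pi>" and nsub: "\<not> \<pi>' \<subseteq> \<pi>"
    and near: "dim \<pi> + dim (\<pi>' \<inter> orth_compl \<pi>) \<le> d"
  shows "\<exists>\<sigma>. subspace \<sigma> \<and> \<sigma> \<subset> \<pi> \<and> spine r \<sigma> \<subseteq> S"
proof -
  define A where "A = \<pi>' \<inter> orth_compl \<pi>"
  have A: "subspace A" "\<pi> \<inter> A \<subseteq> {0}"
    using \<pi>'(1) Int_orth_compl_trivial by (auto simp: A_def subspace_inter)
  have dim_\<pi>A: "dim (span (\<pi> \<union> A)) = dim \<pi> + dim A"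
    using dim_subspace_span_Un[OF \<pi>(1) A(1)] A(2) dim_eq_0[of "\<pi> \<inter> A"] by simp
  \<comment> \<open>A nonzero \<open>x\<close> in \<open>A\<close> costs no dimension; if
    \<open>A\<close> is trivial, \<open>dim \<pi> + 1 \<le> r + 1 \<le> d\<close> leaves room for
    any \<open>x\<close>.\<close>
  have "\<exists>x. x \<in> \<pi>' \<and> x \<notin> \<pi> \<and> dim (span (insert x (\<pi> \<union> A))) \<le> d"
  proof (cases "A \<subseteq> {0}")
    case False
    then obtain x where x: "x \<in> A" "x \<noteq> 0"
      by blast
    then have "span (insert x (\<pi> \<union> A)) = span (\<pi> \<union> A)"
      by (simp add: insert_absorb)
    then show ?thesis
      using x A dim_\<pi>A near by (intro exI[of _ x]) (auto simp: A_def)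
  next
    case True
    then have "dim A = 0"
      by (simp add: dim_eq_0)
    moreover have "dim \<pi> + 1 \<le> d"
      using \<pi>(2) r_less by simp
    ultimately have "dim (span (insert x (\<pi> \<union> A))) \<le> d" for x
      using dim_\<pi>A by (simp add: dim_insert)
    then show ?thesis
      using nsub by blast
  qed
  then obtain x where x: "x \<in> \<pi>'" "x \<notin> \<pi>" and dim_x: "dim (span (insert x (\<pi> \<union> A))) \<le> d"
    by blast
  obtain \<zeta> where \<zeta>: "subspace \<zeta>" "span (insert x (\<pi> \<union> A)) \<subseteq> \<zeta>" "dim \<zeta> = d"
    using subspace_between[of "span (insert x (\<pi> \<union> A))" UNIV d] dim_x d_less by auto
  have sub: "x \<in> \<zeta>" "\<pi> \<subseteq> \<zeta>" "A \<subseteq> \<zeta>"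
    using \<zeta>(2) span_superset[of "insert x (\<pi> \<union> A)"] by auto
  have "\<pi>' \<inter> orth_compl \<zeta> \<subseteq> A"
    using sub(2) by (auto simp: A_def orth_compl_def)
  then have inj: "\<pi>' \<inter> orth_compl \<zeta> \<subseteq> {0}"
    using sub(3) Int_orth_compl_trivial by blast
  define R where "R = orth_proj \<zeta> ` \<pi>'"
  have R: "subspace R" "dim R = dim \<pi>'" "R \<subseteq> \<zeta>"
    using subspace_orth_proj_image[OF \<zeta>(1) \<pi>'(1)] orth_proj_in[OF \<zeta>(1)]
      dim_orth_proj_image_eq[OF \<zeta>(1) \<pi>'(1) inj] by (auto simp: R_def)
  have "x \<in> R"
    using x(1) orth_proj_ident[OF \<zeta>(1) sub(1)] by (force simp: R_def)
  \<comment> \<open>If \<open>\<pi> \<subseteq> R\<close>, then \<open>dim R \<le> dim \<pi>\<close>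
    gives equality, but \<open>x\<close> is in \<open>R\<close> and not in
    \<open>\<pi>\<close>.\<close>
  then have "\<not> \<pi> \<subseteq> R"
    using subspace_dim_equal[OF \<pi>(1) R(1)] R(2) le x(2) by auto
  then obtain z where z: "z \<in> \<pi>" "z \<notin> R"
    by blast
  then obtain \<mu> where \<mu>: "subspace \<mu>" "R \<subseteq> \<mu>" "\<mu> \<subseteq> \<zeta>" "z \<notin> \<mu>" "dim \<mu> = r"
    using subspace_between_avoiding[OF R(1) \<zeta>(1) R(3), of z r] sub(2) R(2) le \<pi>(2) \<zeta>(3) r_less
    by auto
  then have \<mu>_gr: "\<mu> \<in> grassmannian r"
    by (simp add: grassmannian_def)
  obtain \<eta>' where "\<eta>' \<in> grassmannian r" "\<pi>' \<subseteq> \<eta>'" "orth_proj \<zeta> ` \<eta>' = \<mu>"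
    using orth_proj_image_extension[OF \<zeta>(1) \<pi>'(1) inj \<mu>_gr _ \<mu>(3)] \<mu>(2) by (auto simp: R_def)
  moreover from this have "\<eta>' \<in> S"
    using \<pi>'(2) by (auto simp: spine_def)
  moreover obtain \<eta> where "subspace \<eta>" "\<pi> \<subseteq> \<eta>" "\<eta> \<subseteq> \<zeta>" "dim \<eta> = r"
    using subspace_between[OF \<pi>(1) \<zeta>(1) sub(2) \<pi>(2)] \<zeta>(3) r_less by auto
  moreover from this have "\<eta> \<in> S"
    using \<pi>(3) by (auto simp: mem_spine)
  ultimately have "\<mu> \<in> S"
    using saturatedD[OF _ _ \<mu>_gr \<zeta>(1,3)] by blast
  moreover have "span (\<pi> \<union> \<mu>) \<subseteq> \<zeta>"
    using \<zeta>(1) sub(2) \<mu>(3) by (intro span_minimal) auto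
  then have "dim (span (\<pi> \<union> \<mu>)) \<le> d"
    using dim_subset[of "span (\<pi> \<union> \<mu>)" \<zeta>] \<zeta>(3) by simp
  ultimately show ?thesis
    using reduce_spine_near[OF \<pi>] z(1) \<mu>(4) by blast
qed

section \<open>Minimal full subspaces and the decomposition\<close>

definition min_spines :: "'v set set" where
  "min_spines = {\<pi>. subspace \<pi> \<and> dim \<pi> \<le> r \<and> spine r \<pi> \<subseteq> S \<and>
     (\<forall>\<sigma>. subspace \<sigma> \<and> \<sigma> \<subset> \<pi> \<longrightarrow> \<not> spine r \<sigma> \<subseteq> S)}"

lemma ex_min_spine:
  assumes "subspace \<pi>" "dim \<pi> \<le> r" "spine r \<pi> \<subseteq> S"
  shows "\<exists>\<sigma>\<in>min_spines. \<sigma> \<subseteq> \<pi>"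
  using assms
proof (induction "dim \<pi>" arbitrary: \<pi> rule: less_induct)
  case less
  show ?case
  proof (cases "\<pi> \<in> min_spines")
    case False
    then obtain \<sigma> where \<sigma>: "subspace \<sigma>" "\<sigma> \<subset> \<pi>" "spine r \<sigma> \<subseteq> S"
      using less.prems by (auto simp: min_spines_def)
    then have "dim \<sigma> < dim \<pi>"
      using subspace_dim_less less.prems(1) by blast
    then have "\<exists>\<tau>\<in>min_spines. \<tau> \<subseteq> \<sigma>"
      using less.hyps[of \<sigma>] \<sigma> less.prems(2) by simp
    then show ?thesis
      using \<sigma>(2) by blast
  qed auto
qed

lemma min_spines_distal:
  assumes "\<pi> \<in> min_spines" "\<pi>' \<in> min_spines" "\<pi> \<noteq> \<pi>'"
  shows "distal d \<pi> \<pi>'"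
proof -
  have min: "subspace \<pi>" "dim \<pi> \<le> r" "spine r \<pi> \<subseteq> S"
    "subspace \<pi>'" "dim \<pi>' \<le> r" "spine r \<pi>' \<subseteq> S"
    using assms(1,2) by (auto simp: min_spines_def)
  have irred: "\<not> (\<exists>\<sigma>. subspace \<sigma> \<and> \<sigma> \<subset> \<pi> \<and> spine r \<sigma> \<subseteq> S)"
    "\<not> (\<exists>\<sigma>. subspace \<sigma> \<and> \<sigma> \<subset> \<pi>' \<and> spine r \<sigma> \<subseteq> S)"
    using assms(1,2) by (auto simp: min_spines_def)
  then have nsub: "\<not> \<pi> \<subseteq> \<pi>'" "\<not> \<pi>' \<subseteq> \<pi>"
    using assms(3) min by blast+
  have "dim \<pi>' + dim (\<pi> \<inter> orth_compl \<pi>') > d"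
  \<comment> \<open>\<open>reduce_spine\<close> shrinks the subspace of larger dimension, so the
    roles depend on this comparison; the symmetric dimension formula turns one inequality into the
    other.\<close>
  proof (cases "dim \<pi>' \<le> dim \<pi>")
    case True
    then have "dim \<pi> + dim (\<pi>' \<inter> orth_compl \<pi>) > d"
      using reduce_spine[OF min(1-4,6) _ nsub(2)] irred(1) by (meson not_le)
    then show ?thesis
      using dim_Int_orth_compl_symmetric[OF min(1,4)] by simp
  next
    case False
    then show ?thesis
      using reduce_spine[OF min(4-6,1,3) _ nsub(1)] irred(2) by (meson nat_le_linear not_le)
  qed
  then show ?thesis
    using min r_less by (auto simp: distal_def)
qed

text \<open>The minimal full subspaces index themselves. Each member of \<open>S\<close> is full,
  hence contains one of them; a common member of two of their spines would have dimension above
  \<open>d > r\<close>.\<close>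

lemma saturated_imp_spine_decomposition: "spine_decomposition r d S min_spines id"
  unfolding spine_decomposition_def
proof (intro conjI)
  show "\<forall>i\<in>min_spines. subspace (id i) \<and> dim (id i) \<le> r"
    by (auto simp: min_spines_def)
  show "S = (\<Union>i\<in>min_spines. spine r (id i))"
  proof
    show "S \<subseteq> (\<Union>i\<in>min_spines. spine r (id i))"
    proof
      fix \<eta> assume "\<eta> \<in> S"
      then have \<eta>: "\<eta> \<in> grassmannian r"
        using S_subset by blast
      then obtain \<sigma> where "\<sigma> \<in> min_spines" "\<sigma> \<subseteq> \<eta>"
        using ex_min_spine[of \<eta>] spine_self[OF \<eta>] \<open>\<eta> \<in> S\<close> by (auto simp: grassmannian_def)
      then show "\<eta> \<in> (\<Union>i\<in>min_spines. spine r (id i))"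
        using \<eta> by (auto simp: spine_def)
    qed
  qed (auto simp: min_spines_def)
  show "disjoint_family_on (\<lambda>i. spine r (id i)) min_spines"
    unfolding disjoint_family_on_def
  proof (intro ballI impI)
    fix \<pi> \<pi>' assume "\<pi> \<in> min_spines" "\<pi>' \<in> min_spines" "\<pi> \<noteq> \<pi>'"
    then have "dim W > d" if "W \<in> spine r \<pi>" "W \<in> spine r \<pi>'" for W
      using that distal_separates[OF min_spines_distal] by (auto simp: mem_spine)
    then show "spine r (id \<pi>) \<inter> spine r (id \<pi>') = {}"
      using r_less by (fastforce simp: mem_spine)
  qed
  show "\<forall>i\<in>min_spines. \<forall>j\<in>min_spines. i \<noteq> j \<longrightarrow> distal d (id i) (id j)"
    using min_spines_distal by simp
qed

end

theorem tau_saturated_iff_spine_decomposition: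
  assumes "1 \<le> r" "r < d" "d < dim UNIV" "S \<subseteq> grassmannian r"
  shows "tau_saturated r d S \<longleftrightarrow> (\<exists>I \<pi>. spine_decomposition r d S I \<pi>)"
  using saturated_imp_spine_decomposition[OF assms] spine_decomposition_imp_saturated by blast

end

section \<open>Specialisation to real and complex scalars\<close>

theorem theorem0p2:
  fixes n r d :: nat
    and scale\<^sub>R :: "real \<Rightarrow> 'v::ab_group_add \<Rightarrow> 'v"
    and ip\<^sub>R :: "'v \<Rightarrow> 'v \<Rightarrow> real"
    and scale\<^sub>C :: "complex \<Rightarrow> 'w::ab_group_add \<Rightarrow> 'w"
    and ip\<^sub>C :: "'w \<Rightarrow> 'w \<Rightarrow> complex"
  assumes "1 \<le> r" and "r < d" and "d < n" and "n \<ge> 3"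
  shows
    "(fin_dim_hilbert_space scale\<^sub>R id ip\<^sub>R \<and> vector_space.dim scale\<^sub>R UNIV = n \<longrightarrow>
        (\<forall>S \<subseteq> fin_dim_hilbert_space.grassmannian scale\<^sub>R r.
           fin_dim_hilbert_space.tau_saturated scale\<^sub>R ip\<^sub>R r d S \<longleftrightarrow>
           (\<exists>I \<pi>. fin_dim_hilbert_space.spine_decomposition scale\<^sub>R ip\<^sub>R r d S I \<pi>)))
     \<and>
     (fin_dim_hilbert_space scale\<^sub>C cnj ip\<^sub>C \<and> vector_space.dim scale\<^sub>C UNIV = n \<longrightarrow>
        (\<forall>S \<subseteq> fin_dim_hilbert_space.grassmannian scale\<^sub>C r.
           fin_dim_hilbert_space.tau_saturated scale\<^sub>C ip\<^sub>C r d S \<longleftrightarrow>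
           (\<exists>I \<pi>. fin_dim_hilbert_space.spine_decomposition scale\<^sub>C ip\<^sub>C r d S I \<pi>)))"
proof (intro conjI impI allI; elim conjE)
  fix S
  assume R: "fin_dim_hilbert_space scale\<^sub>R id ip\<^sub>R" "vector_space.dim scale\<^sub>R UNIV = n"
    and S: "S \<subseteq> fin_dim_hilbert_space.grassmannian scale\<^sub>R r"
  interpret fin_dim_hilbert_space scale\<^sub>R id ip\<^sub>R
    by (rule R(1))
  interpret conjugation_hilbert_space scale\<^sub>R id ip\<^sub>R
    by unfold_locales auto
  show "fin_dim_hilbert_space.tau_saturated scale\<^sub>R ip\<^sub>R r d S \<longleftrightarrow>
      (\<exists>I \<pi>. fin_dim_hilbert_space.spine_decomposition scale\<^sub>R ip\<^sub>R r d S I \<pi>)"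
    using tau_saturated_iff_spine_decomposition assms(1-3) R(2) S by blast
next
  fix S
  assume C: "fin_dim_hilbert_space scale\<^sub>C cnj ip\<^sub>C" "vector_space.dim scale\<^sub>C UNIV = n"
    and S: "S \<subseteq> fin_dim_hilbert_space.grassmannian scale\<^sub>C r"
  interpret fin_dim_hilbert_space scale\<^sub>C cnj ip\<^sub>C
    by (rule C(1))
  interpret conjugation_hilbert_space scale\<^sub>C cnj ip\<^sub>C
    by unfold_locales auto
  show "fin_dim_hilbert_space.tau_saturated scale\<^sub>C ip\<^sub>C r d S \<longleftrightarrow>
      (\<exists>I \<pi>. fin_dim_hilbert_space.spine_decomposition scale\<^sub>C ip\<^sub>C r d S I \<pi>)"
    using tau_saturated_iff_spine_decomposition assms(1-3) C(2) S by blast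
qed

end
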